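(* Consider Algorithm CLVR (see context) applied to the primal-dual form $\min_{x\ge0}\max_{y\in\mathbb R^n}\{c^Tx+y^TAx-y^Tb\}$ of the standard-form linear program $\min\{c^Tx:Ax=b,\,x\ge0\}$, with input $w_0=(x_0,y_0)$ and output $\tilde w_k=(\tilde x_k,\tilde y_k)$ after $k\ge1$ iterations. Given $\gamma>0$ (the parameter of the algorithm), let $w^*=\arg\min_{w\in\mathcal W^*}\|w_0-w\|_{(\gamma)}$ and $C_0=\gamma+1/\gamma+(\sqrt2+1)\|w_0-w^*\|_{(\gamma)}+\|w^*\|_{(\gamma)}$. Let $H_\gamma>0$ be a constant (generalized Hoffman constant) such that $\mathrm{LPMetric}(w)\ge H_\gamma\,\mathrm{dist}(w,\mathcal W^* )_{(\gamma)}$ for all $w$. Then $$\mathbb E\Big[\sqrt{\mathrm{dist}(\tilde w_k,\mathcal W^* )_{(\gamma)}}\Big]\le5\sqrt{\frac{\hat LmC_0}{H_\gamma k}}\sqrt{\mathrm{dist}(w_0,\mathcal W^* )_{(\gamma)}},$$ $$\mathbb E\Big[\sqrt{\mathrm{LPMetric}(\tilde w_k)}\Big]\le5\sqrt{\frac{\hat LmC_0}{H_\gamma k}}\sqrt{\mathrm{LPMetric}(w_0)}.$$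
   Context: Here $c\in\mathbb R^d$, $A\in\mathbb R^{n\times d}$, $b\in\mathbb R^n$, $\mathcal X=\{x\in\mathbb R^d:x\ge0\}$, and $\mathcal L(x,y)=c^Tx+y^TAx-y^Tb$. $\mathcal W^*$ is the set of primal-dual solutions, i.e. $(x^*,y^* )\in\mathcal X\times\mathbb R^n$ with $\mathcal L(x^*,y)\le\mathcal L(x^*,y^* )\le\mathcal L(x,y^* )$ for all $x\in\mathcal X,y\in\mathbb R^n$; it is assumed nonempty. For $w=(x,y)$: $\|w\|_{(\gamma)}=\sqrt{\gamma\|x\|^2+\frac1\gamma\|y\|^2}$, $\mathrm{dist}(w,\mathcal W^* )_{(\gamma)}=\min_{w'\in\mathcal W^*}\|w-w'\|_{(\gamma)}$, and $$\mathrm{LPMetric}(x,y)=\sqrt{\|\max\{-x,0\}\|_2^2+\|Ax-b\|_2^2+\|\max\{-A^Ty-c,0\}\|_2^2+|\max\{c^Tx+b^Ty,0\}|^2}$$ (max entrywise); $\mathrm{LPMetric}(w)=\mathrm{LPMetric}(x,y)$. $[n]$ is partitioned into nonempty blocks $S^1,\dots,S^m$; $A^{S^j}$ is the submatrix of rows of $A$ indexed by $S^j$, $A^{S^j,T}$ its transpose, $y^{S^j},b^{S^j}$ the corresponding subvectors; $\hat L=\max_{j\in[m]}\|A^{S^j}\|>0$ (spectral norm). Algorithm CLVR specialized to this LP (regularizer $r\equiv0$, strong convexity constant $\sigma=0$). Input: $x_0\in\mathcal X$, $y_0\in\mathbb R^n$, $z_0=A^Ty_0$, $\gamma>0$. Step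 sizes $a_k=\frac1{2\hat Lm}$ and $A_k=\frac k{2\hat Lm}$ for $k\ge1$; $q_0=a_1(z_0+c)$. For $k=1,2,\dots$: (1) $x_k$ is the Euclidean projection of $x_0-\frac1\gamma q_{k-1}$ onto $\mathcal X$; (2) pick $j_k$ uniformly at random in $[m]$ (independently of the past); (3) $y_k^{S^{j_k}}=y_{k-1}^{S^{j_k}}+\gamma ma_k(A^{S^{j_k}}x_k-b^{S^{j_k}})$, and $y_k^{S^i}=y_{k-1}^{S^i}$ for $i\ne j_k$; (4) $z_k=z_{k-1}+A^{S^{j_k},T}(y_k^{S^{j_k}}-y_{k-1}^{S^{j_k}})$; (5) $q_k=q_{k-1}+a_{k+1}(z_k+c)+ma_k(z_k-z_{k-1})$. The output after $k$ iterations is $\tilde x_k=\frac1{A_k}\sum_{i=1}^ka_ix_i$, $\tilde y_k=\frac1{A_k}\sum_{i=1}^k(a_iy_i+(m-1)a_i(y_i-y_{i-1}))$. Expectations are over the randomness of the algorithm. *)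

theory Defs
  imports "HOL-Probability.Probability"
begin

text \<open>
  The data are \<open>A :: real^'d^'n\<close> (n rows, d columns), \<open>b :: real^'n\<close> and \<open>c :: real^'d\<close>;
  a primal-dual pair is an element of \<open>(real^'d) \<times> (real^'n)\<close>.
\<close>

section \<open>The linear program and its saddle-point form\<close>

definition nonneg_orthant :: "(real^'d) set" where
  "nonneg_orthant = {x. \<forall>i. 0 \<le> x $ i}"

definition lagrangian ::
    "real^'d^'n \<Rightarrow> real^'n \<Rightarrow> real^'d \<Rightarrow> real^'d \<Rightarrow> real^'n \<Rightarrow> real" where
  "lagrangian A b c x y = c \<bullet> x + y \<bullet> (A *v x) - y \<bullet> b"

definition primal_dual_solutions ::
    "real^'d^'n \<Rightarrow> real^'n \<Rightarrow> real^'d \<Rightarrow> ((real^'d) \<times> (real^'n)) set" where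
  "primal_dual_solutions A b c =
     {(xs, ys). xs \<in> nonneg_orthant \<and>
        (\<forall>x\<in>nonneg_orthant. \<forall>y.
           lagrangian A b c xs y \<le> lagrangian A b c xs ys \<and>
           lagrangian A b c xs ys \<le> lagrangian A b c x ys)}"

definition weighted_norm :: "real \<Rightarrow> (real^'d) \<times> (real^'n) \<Rightarrow> real" where
  "weighted_norm \<gamma> w = sqrt (\<gamma> * (norm (fst w))\<^sup>2 + 1 / \<gamma> * (norm (snd w))\<^sup>2)"

text \<open>The infimum is attained whenever \<open>W\<close> is nonempty and closed and \<open>\<gamma> > 0\<close>, as is the case for the
  set of primal-dual solutions.\<close>

definition weighted_dist ::
    "real \<Rightarrow> (real^'d) \<times> (real^'n) \<Rightarrow> ((real^'d) \<times> (real^'n)) set \<Rightarrow> real" where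
  "weighted_dist \<gamma> w W = (INF w'\<in>W. weighted_norm \<gamma> (w - w'))"

definition pos_part :: "real^'i \<Rightarrow> real^'i" where
  "pos_part v = (\<chi> i. max (v $ i) 0)"

definition lp_metric ::
    "real^'d^'n \<Rightarrow> real^'n \<Rightarrow> real^'d \<Rightarrow> (real^'d) \<times> (real^'n) \<Rightarrow> real" where
  "lp_metric A b c w = (case w of (x, y) \<Rightarrow>
     sqrt ((norm (pos_part (- x)))\<^sup>2
         + (norm (A *v x - b))\<^sup>2
         + (norm (pos_part (- (transpose A *v y) - c)))\<^sup>2
         + \<bar>max (c \<bullet> x + b \<bullet> y) 0\<bar>\<^sup>2))"

section \<open>Row blocks\<close>

text \<open>
  The submatrix of the rows in \<open>I\<close>, and the subvector of the entries in \<open>I\<close>, are represented in the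
  full dimension by zeroing everything outside \<open>I\<close>. This changes neither the operator norm of
  the submatrix nor the product of its transpose with a subvector.
\<close>

definition row_block :: "real^'d^'n \<Rightarrow> 'n set \<Rightarrow> real^'d^'n" where
  "row_block A I = (\<chi> i. if i \<in> I then A $ i else 0)"

definition subvec :: "real^'n \<Rightarrow> 'n set \<Rightarrow> real^'n" where
  "subvec v I = (\<chi> i. if i \<in> I then v $ i else 0)"

definition is_block_partition :: "(nat \<Rightarrow> 'n set) \<Rightarrow> nat \<Rightarrow> bool" where
  "is_block_partition S m \<longleftrightarrow>
     disjoint_family_on S {1..m} \<and> (\<Union>j\<in>{1..m}. S j) = UNIV \<and> (\<forall>j\<in>{1..m}. S j \<noteq> {})"

definition Lhat :: "real^'d^'n \<Rightarrow> (nat \<Rightarrow> 'n set) \<Rightarrow> nat \<Rightarrow> real" where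
  "Lhat A S m = (MAX j\<in>{1..m}. onorm ((*v) (row_block A (S j))))"

section \<open>Algorithm CLVR\<close>

definition step_a :: "real^'d^'n \<Rightarrow> (nat \<Rightarrow> 'n set) \<Rightarrow> nat \<Rightarrow> nat \<Rightarrow> real" where
  "step_a A S m k = 1 / (2 * Lhat A S m * real m)"

definition step_A :: "real^'d^'n \<Rightarrow> (nat \<Rightarrow> 'n set) \<Rightarrow> nat \<Rightarrow> nat \<Rightarrow> real" where
  "step_A A S m k = real k / (2 * Lhat A S m * real m)"

text \<open>
  The iterate \<open>(x\<^sub>k, y\<^sub>k, z\<^sub>k, q\<^sub>k)\<close> along a fixed sequence \<open>j\<close> of sampled blocks, where \<open>j k\<close> is the
  block drawn in iteration \<open>k \<ge> 1\<close>. The vector added to \<open>y\<close> vanishes outside the drawn block, so the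
  other blocks are left unchanged.
\<close>

primrec clvr_state ::
    "real^'d^'n \<Rightarrow> real^'n \<Rightarrow> real^'d \<Rightarrow> (nat \<Rightarrow> 'n set) \<Rightarrow> nat \<Rightarrow> real \<Rightarrow> real^'d \<Rightarrow> real^'n \<Rightarrow>
     (nat \<Rightarrow> nat) \<Rightarrow> nat \<Rightarrow> (real^'d) \<times> (real^'n) \<times> (real^'d) \<times> (real^'d)" where
  "clvr_state A b c S m \<gamma> x0 y0 j 0 =
     (x0, y0, transpose A *v y0, step_a A S m 1 *\<^sub>R (transpose A *v y0 + c))"
| "clvr_state A b c S m \<gamma> x0 y0 j (Suc k) =
     (let (x, y, z, q) = clvr_state A b c S m \<gamma> x0 y0 j k;
          I = S (j (Suc k));
          x' = closest_point nonneg_orthant (x0 - (1 / \<gamma>) *\<^sub>R q);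
          y' = y + (\<gamma> * real m * step_a A S m (Suc k)) *\<^sub>R (row_block A I *v x' - subvec b I);
          z' = z + transpose (row_block A I) *v (subvec y' I - subvec y I);
          q' = q + step_a A S m (Suc (Suc k)) *\<^sub>R (z' + c)
                 + (real m * step_a A S m (Suc k)) *\<^sub>R (z' - z)
      in (x', y', z', q'))"

definition clvr_x ::
    "real^'d^'n \<Rightarrow> real^'n \<Rightarrow> real^'d \<Rightarrow> (nat \<Rightarrow> 'n set) \<Rightarrow> nat \<Rightarrow> real \<Rightarrow> real^'d \<Rightarrow> real^'n \<Rightarrow>
     (nat \<Rightarrow> nat) \<Rightarrow> nat \<Rightarrow> real^'d" where
  "clvr_x A b c S m \<gamma> x0 y0 j k = fst (clvr_state A b c S m \<gamma> x0 y0 j k)"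

definition clvr_y ::
    "real^'d^'n \<Rightarrow> real^'n \<Rightarrow> real^'d \<Rightarrow> (nat \<Rightarrow> 'n set) \<Rightarrow> nat \<Rightarrow> real \<Rightarrow> real^'d \<Rightarrow> real^'n \<Rightarrow>
     (nat \<Rightarrow> nat) \<Rightarrow> nat \<Rightarrow> real^'n" where
  "clvr_y A b c S m \<gamma> x0 y0 j k = fst (snd (clvr_state A b c S m \<gamma> x0 y0 j k))"

definition clvr_output ::
    "real^'d^'n \<Rightarrow> real^'n \<Rightarrow> real^'d \<Rightarrow> (nat \<Rightarrow> 'n set) \<Rightarrow> nat \<Rightarrow> real \<Rightarrow> real^'d \<Rightarrow> real^'n \<Rightarrow>
     (nat \<Rightarrow> nat) \<Rightarrow> nat \<Rightarrow> (real^'d) \<times> (real^'n)" where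
  "clvr_output A b c S m \<gamma> x0 y0 j k =
     ((1 / step_A A S m k) *\<^sub>R
        (\<Sum>i=1..k. step_a A S m i *\<^sub>R clvr_x A b c S m \<gamma> x0 y0 j i),
      (1 / step_A A S m k) *\<^sub>R
        (\<Sum>i=1..k. step_a A S m i *\<^sub>R clvr_y A b c S m \<gamma> x0 y0 j i
           + ((real m - 1) * step_a A S m i) *\<^sub>R
               (clvr_y A b c S m \<gamma> x0 y0 j i - clvr_y A b c S m \<gamma> x0 y0 j (i - 1))))"

text \<open>\<open>J k\<close> for \<open>k \<ge> 1\<close> are independent and uniformly distributed on \<open>{1..m}\<close>.\<close>

definition uniform_block_sampling :: "'w measure \<Rightarrow> nat \<Rightarrow> (nat \<Rightarrow> 'w \<Rightarrow> nat) \<Rightarrow> bool" where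
  "uniform_block_sampling M m J \<longleftrightarrow>
     prob_space.indep_vars M (\<lambda>_. count_space UNIV) J {1..} \<and>
     (\<forall>k\<ge>1. distr M (count_space UNIV) (J k) = measure_pmf (pmf_of_set {1..m}))"

end

theory Submission
  imports Defs
begin

text \<open>
  Write \<open>D\<close> for the weighted distance of \<open>w\<^sub>0\<close> to its nearest solution \<open>w\<^sup>* = (x\<^sup>*, y\<^sup>*)\<close>, and
  \<open>a = 1 / (2 L m)\<close> for the constant step size. Both bounds follow from the single estimate
  \<open>k a \<cdot> E LPMetric(w\<^sub>k) \<le> 5 C\<^sub>0 D\<close> for the output \<open>w\<^sub>k\<close>, a consequence of \<open>mean_lp_metric_le\<close>: Jensen's inequality
  turns it into a bound on the mean of the square root, and the Hoffman inequality, once at the output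
  and once at \<open>w\<^sub>0\<close>, exchanges the metric and the distance.

  Along a fixed sequence of blocks, CLVR is lazy dual averaging in \<open>x\<close> with an optimistic prediction
  of the next slope, and a gradient ascent in \<open>y\<close> that uses the random direction \<open>m\<close> times the drawn
  block of \<open>A x\<^sub>i - b\<close> in place of \<open>A x\<^sub>i - b\<close>. The two regret bounds add up to a bound
  (\<open>gap_le\<close>) on \<open>k a (\<L>(x, v) - \<L>(u, y))\<close> for the output \<open>(x, y)\<close> and all \<open>u \<ge> 0\<close> and \<open>v\<close>. Its only random
  error is the sum of the pairings \<open>(v - y\<^sub>i\<^sub>-\<^sub>1) \<bullet> \<xi>\<^sub>i\<close>, where \<open>\<xi>\<^sub>i\<close> (\<open>noise\<close>) has mean zero
  given the past.

  The test points that reveal the metric depend on the output, so it does not suffice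
  that the error has mean zero for each fixed \<open>v\<close>. Three observations avoid a supremum over \<open>v\<close>.

  \<^item> At \<open>(u, v) = w\<^sup>*\<close> the gap is nonnegative. So \<open>W = D\<^sup>2 / 2 + \<Sum> (y\<^sup>* - y\<^sub>i\<^sub>-\<^sub>1) \<bullet> \<xi>\<^sub>i\<close> is a nonnegative
    random variable of mean \<open>D\<^sup>2 / 2\<close>, and \<open>4 W\<close> dominates the squared distance of the last
    iterate to \<open>w\<^sup>*\<close> plus the sum of \<open>\<parallel>y\<^sub>i - y\<^sub>i\<^sub>-\<^sub>1\<parallel>\<^sup>2 / \<gamma>\<close> (\<open>energy_le\<close>).
  \<^item> The two residuals in the metric can be read off the iterates. The sum of the residuals
    \<open>a (A x\<^sub>i - b)\<close> is \<open>(y\<^sub>k - y\<^sub>0) / \<gamma>\<close> plus the total noise, and the accumulated slope is, up to the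
    last correction, the vector \<open>q\<close> for which \<open>x\<^sub>k\<close> is the projection of \<open>x\<^sub>0 - q / \<gamma>\<close>. The total noise is controlled in
    mean square, since its variance is at most that of the dual steps (\<open>mean_total_noise_le\<close>).
  \<^item> The objective gap \<open>c \<bullet> x + b \<bullet> y\<close> is the duality gap at \<open>(u, v) = (0, 0)\<close>. Compared with
    \<open>w\<^sup>*\<close>, its random error only changes by the pairing of \<open>y\<^sup>*\<close> with the total noise
    (\<open>noise_pairing_shift\<close>). Besides terms linear in \<open>w\<^sup>*\<close>, the bound
    consists of \<open>W\<close>, which is nonnegative, so it also holds for the positive part.

  Together, the metric is at most linear in \<open>sqrt W\<close> and in the norm of the total noise, plus \<open>W\<close>
  (\<open>lp_metric_le\<close>), and every term has a mean of order \<open>D\<close> or \<open>D\<^sup>2\<close>. The output depends on finitely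
  many uniform draws, so all means are averages over finitely many block sequences
  (\<open>integral_uniform_block_sampling\<close>).
\<close>

section \<open>Means over block sequences\<close>

text \<open>
  Sequences are restricted to the indices \<open>1, \<dots>, k\<close> (and undefined elsewhere) so that there are
  finitely many of them.
\<close>

definition block_seqs :: "nat \<Rightarrow> nat \<Rightarrow> (nat \<Rightarrow> nat) set" where
  "block_seqs m k = {1..k} \<rightarrow>\<^sub>E {1..m}"

definition seq_mean :: "nat \<Rightarrow> nat \<Rightarrow> ((nat \<Rightarrow> nat) \<Rightarrow> real) \<Rightarrow> real" where
  "seq_mean m k f = (\<Sum>j\<in>block_seqs m k. f j) / real m ^ k"

lemma finite_block_seqs [simp]: "finite (block_seqs m k)"
  by (simp add: block_seqs_def finite_PiE)

lemma block_seqs_mem: "j \<in> block_seqs m k \<Longrightarrow> i \<in> {1..k} \<Longrightarrow> j i \<in> {1..m}"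
  by (auto simp: block_seqs_def)

lemma card_block_seqs: "card (block_seqs m k) = m ^ k"
  by (simp add: block_seqs_def card_PiE)

text \<open>
  Tower property: the last block can be averaged out first, with the past kept fixed. Every
  martingale argument below is an induction on \<open>k\<close> by this equation.
\<close>

lemma seq_mean_Suc:
  "seq_mean m (Suc k) f = seq_mean m k (\<lambda>j. (\<Sum>l=1..m. f (j(Suc k := l))) / real m)"
proof -
  have "{1..Suc k} = insert (Suc k) {1..k}"
    by auto
  then have eq: "block_seqs m (Suc k) = (\<lambda>(l, j). j(Suc k := l)) ` ({1..m} \<times> block_seqs m k)"
    by (simp add: block_seqs_def PiE_insert_eq)
  have "inj_on (\<lambda>(l, j). j(Suc k := l)) ({1..m} \<times> block_seqs m k)"
    unfolding block_seqs_def by (rule inj_combinator) simp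
  then have "(\<Sum>j\<in>block_seqs m (Suc k). f j) = (\<Sum>(l, j)\<in>{1..m} \<times> block_seqs m k. f (j(Suc k := l)))"
    unfolding eq by (subst sum.reindex) (auto simp: case_prod_unfold)
  also have "\<dots> = (\<Sum>j\<in>block_seqs m k. \<Sum>l=1..m. f (j(Suc k := l)))"
    by (subst sum.cartesian_product [symmetric]) (rule sum.swap)
  finally show ?thesis
    by (simp add: seq_mean_def sum_divide_distrib divide_divide_eq_left mult.commute)
qed

lemma seq_mean_mono: "(\<And>j. j \<in> block_seqs m k \<Longrightarrow> f j \<le> g j) \<Longrightarrow> seq_mean m k f \<le> seq_mean m k g"
  by (simp add: seq_mean_def divide_right_mono sum_mono)

lemma seq_mean_cong: "(\<And>j. j \<in> block_seqs m k \<Longrightarrow> f j = g j) \<Longrightarrow> seq_mean m k f = seq_mean m k g"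
  by (simp add: seq_mean_def)

lemma seq_mean_add: "seq_mean m k (\<lambda>j. f j + g j) = seq_mean m k f + seq_mean m k g"
  by (simp add: seq_mean_def sum.distrib add_divide_distrib)

lemma seq_mean_cmult: "seq_mean m k (\<lambda>j. r * f j) = r * seq_mean m k f"
  by (simp add: seq_mean_def sum_distrib_left)

lemma seq_mean_const: "m > 0 \<Longrightarrow> seq_mean m k (\<lambda>j. r) = r"
  by (simp add: seq_mean_def card_block_seqs)

text \<open>Jensen's inequality for the square root: the variance of \<open>f\<close> is nonnegative.\<close>

lemma seq_mean_le_sqrt:
  assumes "m > 0" "\<And>j. j \<in> block_seqs m k \<Longrightarrow> (f j)\<^sup>2 \<le> g j"
  shows "seq_mean m k f \<le> sqrt (seq_mean m k g)"
proof -
  define r where "r = seq_mean m k f"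
  have "0 \<le> seq_mean m k (\<lambda>j. (f j - r)\<^sup>2)"
    by (simp add: seq_mean_def sum_nonneg)
  also have "\<dots> = seq_mean m k (\<lambda>j. (f j)\<^sup>2 + ((- 2 * r) * f j + r\<^sup>2))"
    by (rule seq_mean_cong) (simp add: power2_eq_square algebra_simps)
  also have "\<dots> = seq_mean m k (\<lambda>j. (f j)\<^sup>2) - r\<^sup>2"
    using assms(1) by (simp only: seq_mean_add seq_mean_cmult seq_mean_const r_def [symmetric])
      (simp add: power2_eq_square)
  finally have "r\<^sup>2 \<le> seq_mean m k (\<lambda>j. (f j)\<^sup>2)"
    by simp
  also have "\<dots> \<le> seq_mean m k g"
    by (rule seq_mean_mono) (rule assms(2))
  finally show ?thesis
    unfolding r_def by (rule real_le_rsqrt)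
qed

text \<open>
  The first \<open>k\<close> draws take each value in \<open>block_seqs m k\<close> with probability \<open>1 / m ^ k\<close>, by
  independence. A function of finitely many draws is measurable because these take
  countably many values.
\<close>

lemma integral_uniform_block_sampling:
  assumes prob: "prob_space M" and sampling: "uniform_block_sampling M m J" and m: "m > 0"
    and dep: "\<And>j j'. (\<And>i. i \<in> {1..k} \<Longrightarrow> j i = j' i) \<Longrightarrow> f j = f j'"
  shows "(\<integral>\<omega>. f (\<lambda>i. J i \<omega>) \<partial>M) = seq_mean m k f"
proof -
  interpret prob_space M by fact
  have indep: "indep_vars (\<lambda>_. count_space UNIV) J {1..}"
    and dist: "\<And>i. i \<ge> 1 \<Longrightarrow> distr M (count_space UNIV) (J i) = measure_pmf (pmf_of_set {1..m})"
    using sampling by (auto simp: uniform_block_sampling_def)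
  have meas [measurable]: "J i \<in> measurable M (count_space UNIV)" if "i \<in> {1..k}" for i
    using indep that by (auto simp: indep_vars_def2)
  have prob_J: "prob (J i -` {l} \<inter> space M) = 1 / m" if "i \<in> {1..k}" "l \<in> {1..m}" for i l
  proof -
    have "prob (J i -` {l} \<inter> space M) = measure (distr M (count_space UNIV) (J i)) {l}"
      using meas [OF that(1)] by (simp add: measure_distr)
    also have "\<dots> = 1 / m"
      using that m dist [of i] by (simp add: measure_pmf_single)
    finally show ?thesis .
  qed
  have AE_J: "AE \<omega> in M. \<forall>i\<in>{1..k}. J i \<omega> \<in> {1..m}"
  proof (rule AE_finite_allI)
    fix i assume i: "i \<in> {1..k}"
    have "AE l in measure_pmf (pmf_of_set {1..m}). l \<in> {1..m}"
      using m by (simp add: AE_measure_pmf_iff)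
    then have "AE l in distr M (count_space UNIV) (J i). l \<in> {1..m}"
      by (subst dist) (use i in auto)
    then show "AE \<omega> in M. J i \<omega> \<in> {1..m}"
      using meas [OF i] by (subst (asm) AE_distr_iff) auto
  qed simp
  define E where "E j = (\<Inter>i\<in>{1..k}. J i -` {j i} \<inter> space M) \<inter> space M" for j
  have E_sets [measurable]: "E j \<in> sets M" for j
  proof (cases "k = 0")
    case False
    have "J i -` {j i} \<inter> space M \<in> sets M" if "i \<in> {1..k}" for i
      using meas [OF that] by (rule measurable_sets) simp
    then have "(\<Inter>i\<in>{1..k}. J i -` {j i} \<inter> space M) \<in> sets M"
      using False by (intro sets.finite_INT) auto
    then show ?thesis
      unfolding E_def by (rule sets.Int) simp
  qed (simp add: E_def)
  have prob_E: "prob (E j) = 1 / real m ^ k" if j: "j \<in> block_seqs m k" for j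
  proof (cases "k = 0")
    case True
    then show ?thesis by (simp add: E_def prob_space)
  next
    case False
    have "prob (\<Inter>i\<in>{1..k}. J i -` {j i} \<inter> space M) = (\<Prod>i\<in>{1..k}. prob (J i -` {j i} \<inter> space M))"
      using False by (intro indep_varsD [OF indep]) auto
    also have "\<dots> = (\<Prod>i\<in>{1..k}. 1 / real m)"
      using j by (intro prod.cong prob_J refl) (auto dest: block_seqs_mem)
    moreover have "E j = (\<Inter>i\<in>{1..k}. J i -` {j i} \<inter> space M)"
      using False by (auto simp: E_def)
    ultimately show ?thesis by (simp add: power_one_over)
  qed
  have "(\<lambda>\<omega>. \<lambda>i\<in>{1..k}. J i \<omega>) \<in> measurable M (PiM {1..k} (\<lambda>_. count_space UNIV))"
    using meas by (intro measurable_restrict) auto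
  then have "(\<lambda>\<omega>. \<lambda>i\<in>{1..k}. J i \<omega>) \<in> measurable M (count_space ({1..k} \<rightarrow>\<^sub>E UNIV))"
    by (subst (asm) count_space_PiM_finite) auto
  then have "(\<lambda>\<omega>. f (\<lambda>i\<in>{1..k}. J i \<omega>)) \<in> borel_measurable M"
    by (rule measurable_compose) simp
  moreover have "f (\<lambda>i\<in>{1..k}. J i \<omega>) = f (\<lambda>i. J i \<omega>)" for \<omega>
    by (rule dep) simp
  ultimately have f_meas: "(\<lambda>\<omega>. f (\<lambda>i. J i \<omega>)) \<in> borel_measurable M"
    by simp
  have "(\<integral>\<omega>. f (\<lambda>i. J i \<omega>) \<partial>M) = (\<integral>\<omega>. (\<Sum>j\<in>block_seqs m k. f j * indicator (E j) \<omega>) \<partial>M)"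
  proof (rule integral_cong_AE)
    show "AE \<omega> in M. f (\<lambda>i. J i \<omega>) = (\<Sum>j\<in>block_seqs m k. f j * indicator (E j) \<omega>)"
      using AE_J AE_space
    proof eventually_elim
      case (elim \<omega>)
      define j0 where "j0 = (\<lambda>i\<in>{1..k}. J i \<omega>)"
      have j0: "j0 \<in> block_seqs m k"
        using elim by (auto simp: j0_def block_seqs_def)
      have "indicator (E j) \<omega> = (if j = j0 then 1 else 0 :: real)" if "j \<in> block_seqs m k" for j
      proof -
        have "\<omega> \<in> E j \<longleftrightarrow> (\<forall>i\<in>{1..k}. j i = j0 i)"
          using elim by (auto simp: E_def j0_def)
        also have "\<dots> \<longleftrightarrow> j = j0"
          using that j0 by (auto simp: block_seqs_def intro: PiE_ext)
        finally show ?thesis by (simp add: indicator_def)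
      qed
      then have "(\<Sum>j\<in>block_seqs m k. f j * indicator (E j) \<omega>)
          = (\<Sum>j\<in>block_seqs m k. if j = j0 then f j else 0)"
        by (intro sum.cong) auto
      also have "\<dots> = f j0"
        using j0 by simp
      also have "\<dots> = f (\<lambda>i. J i \<omega>)"
        by (rule dep) (simp add: j0_def)
      finally show ?case ..
    qed
    show "(\<lambda>\<omega>. \<Sum>j\<in>block_seqs m k. f j * indicator (E j) \<omega>) \<in> borel_measurable M"
      by (intro borel_measurable_sum borel_measurable_times borel_measurable_const
          borel_measurable_indicator E_sets)
  qed (fact f_meas)
  also have "\<dots> = (\<Sum>j\<in>block_seqs m k. f j * prob (E j))"
    by (subst Bochner_Integration.integral_sum) (auto simp: emeasure_eq_measure)
  also have "\<dots> = seq_mean m k f"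
    by (simp add: prob_E seq_mean_def sum_divide_distrib)
  finally show ?thesis .
qed


section \<open>Block matrices and the nonnegative orthant\<close>

(* The simplifier would turn every product with a transpose into a product from the left. *)
declare transpose_matrix_vector [simp del]

lemma inner_transpose: "x \<bullet> (transpose A *v y) = (A *v x) \<bullet> y" for A :: "real^'d^'n"
  by (metis dot_lmul_matrix inner_commute transpose_matrix_vector)

lemma inner_transpose_left: "(transpose A *v y) \<bullet> x = y \<bullet> (A *v x)" for A :: "real^'d^'n"
  using inner_transpose [of x A y] by (simp add: inner_commute)

lemma row_block_mult_vec: "row_block A I *v x = subvec (A *v x) I"
  by (simp add: vec_eq_iff row_block_def subvec_def matrix_vector_mult_def)

lemma subvec_diff: "subvec (u - v) I = subvec u I - subvec v I"
  by (simp add: vec_eq_iff subvec_def)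

lemma subvec_scaleR: "subvec (r *\<^sub>R v) I = r *\<^sub>R subvec v I"
  by (simp add: vec_eq_iff subvec_def)

lemma subvec_idem [simp]: "subvec (subvec v I) I = subvec v I"
  by (simp add: vec_eq_iff subvec_def)

lemma inner_subvec: "subvec u I \<bullet> v = subvec u I \<bullet> subvec v I"
  by (simp add: inner_vec_def subvec_def if_distrib cong: if_cong)
    (rule sum.cong, auto)

lemma transpose_row_block_mult_subvec:
  "transpose (row_block A I) *v subvec v I = transpose A *v subvec v I"
  by (simp add: vec_eq_iff row_block_def subvec_def matrix_vector_mult_def transpose_def)
    (auto intro!: sum.cong)

lemma norm_transpose_mult_le:
  fixes B :: "real^'d^'n"
  shows "norm (transpose B *v v) \<le> onorm ((*v) B) * norm v"
proof -
  define u where "u = transpose B *v v"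
  have "(norm u)\<^sup>2 = (B *v u) \<bullet> v"
    by (simp add: u_def power2_norm_eq_inner inner_transpose)
  also have "\<dots> \<le> norm (B *v u) * norm v"
    by (rule norm_cauchy_schwarz)
  also have "\<dots> \<le> onorm ((*v) B) * norm u * norm v"
    by (intro mult_right_mono onorm matrix_vector_mul_bounded_linear) simp
  finally have "norm u * norm u \<le> (onorm ((*v) B) * norm v) * norm u"
    by (simp add: power2_eq_square ac_simps)
  moreover have "0 \<le> onorm ((*v) B) * norm v"
    by (simp add: onorm_pos_le matrix_vector_mul_bounded_linear)
  ultimately show ?thesis
    unfolding u_def [symmetric] by (cases "norm u = 0") auto
qed

lemma convex_nonneg_orthant: "convex (nonneg_orthant :: (real^'d) set)"
  by (auto simp: convex_def nonneg_orthant_def)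

lemma closed_nonneg_orthant: "closed (nonneg_orthant :: (real^'d) set)"
  unfolding nonneg_orthant_def by (intro closed_Collect_all closed_Collect_le continuous_intros)

lemma zero_in_nonneg_orthant: "0 \<in> nonneg_orthant"
  by (simp add: nonneg_orthant_def)

lemma nonneg_orthant_sum:
  "(\<And>i. i \<in> I \<Longrightarrow> f i \<in> nonneg_orthant) \<Longrightarrow> sum f I \<in> nonneg_orthant"
  by (auto simp: nonneg_orthant_def intro: sum_nonneg)

lemma nonneg_orthant_scaleR: "r \<ge> 0 \<Longrightarrow> x \<in> nonneg_orthant \<Longrightarrow> r *\<^sub>R x \<in> nonneg_orthant"
  by (auto simp: nonneg_orthant_def)

lemma norm_pos_part_le:
  assumes "\<And>i. u $ i \<le> v $ i"
  shows "norm (pos_part u) \<le> norm v"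
  using assms by (intro norm_le_componentwise_cart) (auto simp: pos_part_def, smt (verit))

text \<open>
  Young's inequality, from expanding \<open>\<parallel>u - r v\<parallel>\<^sup>2 \<ge> 0\<close>.
\<close>

lemma inner_le_weighted_squares:
  fixes u v :: "'a::real_inner"
  assumes r: "r > 0"
  shows "u \<bullet> v \<le> (norm u)\<^sup>2 / (2 * r) + r / 2 * (norm v)\<^sup>2"
proof -
  have "(norm (u - r *\<^sub>R v))\<^sup>2 = (norm u)\<^sup>2 - 2 * r * (u \<bullet> v) + r\<^sup>2 * (norm v)\<^sup>2"
    unfolding power2_norm_eq_inner
    by (simp add: inner_diff_left inner_diff_right inner_commute power2_eq_square algebra_simps)
  then have "(norm u)\<^sup>2 / (2 * r) + r / 2 * (norm v)\<^sup>2 - u \<bullet> v = (norm (u - r *\<^sub>R v))\<^sup>2 / (2 * r)"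
    using r by (simp add: field_simps power2_eq_square)
  also have "\<dots> \<ge> 0"
    using r by simp
  finally show ?thesis by simp
qed

section \<open>The weighted norm\<close>

text \<open>
  This scaling turns the weighted norm into the Euclidean norm of the product space, whose triangle
  and Cauchy-Schwarz inequalities then carry over.
\<close>

definition rescale :: "real \<Rightarrow> (real^'d) \<times> (real^'n) \<Rightarrow> (real^'d) \<times> (real^'n)" where
  "rescale \<gamma> w = (sqrt \<gamma> *\<^sub>R fst w, (1 / sqrt \<gamma>) *\<^sub>R snd w)"

lemma rescale_diff: "rescale \<gamma> (v - w) = rescale \<gamma> v - rescale \<gamma> w"
  by (simp add: rescale_def scaleR_right_diff_distrib)

context
  fixes \<gamma> :: real
  assumes gamma_pos: "\<gamma> > 0"
begin

lemma weighted_norm_eq: "weighted_norm \<gamma> w = norm (rescale \<gamma> w)"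
  using gamma_pos
  by (simp add: weighted_norm_def rescale_def norm_prod_def power_mult_distrib power_divide)

lemma weighted_norm_sq: "(weighted_norm \<gamma> w)\<^sup>2 = \<gamma> * (norm (fst w))\<^sup>2 + (norm (snd w))\<^sup>2 / \<gamma>"
  using gamma_pos by (simp add: weighted_norm_def)

lemma norm_fst_le_weighted_norm: "sqrt \<gamma> * norm (fst w) \<le> weighted_norm \<gamma> w"
  using gamma_pos norm_fst_le [of "sqrt \<gamma> *\<^sub>R fst w" "(1 / sqrt \<gamma>) *\<^sub>R snd w"] by (simp add: weighted_norm_eq rescale_def)

lemma norm_snd_le_weighted_norm: "norm (snd w) / sqrt \<gamma> \<le> weighted_norm \<gamma> w"
  using gamma_pos norm_snd_le [of "(1 / sqrt \<gamma>) *\<^sub>R snd w" "sqrt \<gamma> *\<^sub>R fst w"] by (simp add: weighted_norm_eq rescale_def)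

lemma weighted_norm_triangle: "weighted_norm \<gamma> (u - w) \<le> weighted_norm \<gamma> (u - v) + weighted_norm \<gamma> (w - v)"
proof -
  have "rescale \<gamma> (u - w) = rescale \<gamma> (u - v) - rescale \<gamma> (w - v)"
    by (simp add: rescale_diff)
  then show ?thesis
    by (simp add: weighted_norm_eq norm_triangle_ineq4)
qed

lemma weighted_norm_sq_diff_le:
  "(weighted_norm \<gamma> u)\<^sup>2 - (weighted_norm \<gamma> v)\<^sup>2
    \<le> 2 * weighted_norm \<gamma> w * (weighted_norm \<gamma> (u - w) + weighted_norm \<gamma> (v - w))
      + (weighted_norm \<gamma> (u - w))\<^sup>2 - (weighted_norm \<gamma> (v - w))\<^sup>2"
proof -
  define p where "p = rescale \<gamma> w"
  define d where "d = rescale \<gamma> (u - w)"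
  define e where "e = rescale \<gamma> (v - w)"
  have "rescale \<gamma> u = p + d" "rescale \<gamma> v = p + e"
    by (simp_all add: p_def d_def e_def rescale_diff)
  then have "(weighted_norm \<gamma> u)\<^sup>2 - (weighted_norm \<gamma> v)\<^sup>2 = 2 * (p \<bullet> (d - e)) + (norm d)\<^sup>2 - (norm e)\<^sup>2"
    unfolding weighted_norm_eq power2_norm_eq_inner
    by (simp add: inner_add_left inner_add_right inner_diff_right inner_commute)
  also have "p \<bullet> (d - e) \<le> norm p * (norm d + norm e)"
    by (intro order.trans [OF norm_cauchy_schwarz] mult_left_mono norm_triangle_ineq4) auto
  finally show ?thesis
    by (simp add: weighted_norm_eq p_def d_def e_def)
qed

end

section \<open>Pathwise regret bounds\<close>

locale clvr =
  fixes A :: "real^'d^'n" and b :: "real^'n" and c :: "real^'d"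
    and S :: "nat \<Rightarrow> 'n set" and m :: nat and \<gamma> :: real
    and x0 :: "real^'d" and y0 :: "real^'n"
  assumes partition: "is_block_partition S m"
    and L_pos: "Lhat A S m > 0"
    and x0: "x0 \<in> nonneg_orthant"
    and gamma_pos: "\<gamma> > 0"
begin

abbreviation "L \<equiv> Lhat A S m"
abbreviation "X \<equiv> clvr_x A b c S m \<gamma> x0 y0"
abbreviation "Y \<equiv> clvr_y A b c S m \<gamma> x0 y0"

definition "a = 1 / (2 * L * real m)"

definition "Z j i = fst (snd (snd (clvr_state A b c S m \<gamma> x0 y0 j i)))"
definition "Q j i = snd (snd (snd (clvr_state A b c S m \<gamma> x0 y0 j i)))"

definition "dual_step j i = Y j i - Y j (i - 1)"

text \<open>
  In the gap, iteration \<open>i\<close> uses the extrapolated dual point \<open>y\<^sub>i\<^sub>-\<^sub>1 + m (y\<^sub>i - y\<^sub>i\<^sub>-\<^sub>1)\<close>, whose mean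
  given the past is a full dual step. Its gradient in \<open>x\<close> is \<open>slope\<close>. When \<open>x\<^sub>i\<close> is computed, only the
  part belonging to \<open>y\<^sub>i\<^sub>-\<^sub>1\<close> is known; \<open>correction\<close> is the missing rest, which enters the next \<open>q\<close>.
  The scaled dual step \<open>dual_step / \<gamma>\<close> is an unbiased estimate of \<open>a (A x\<^sub>i - b)\<close>, and \<open>noise\<close> is the
  error of this estimate.
\<close>

definition "correction j i = (real m * a) *\<^sub>R (transpose A *v dual_step j i)"

definition "slope j i = a *\<^sub>R (c + transpose A *v (Y j (i - 1) + real m *\<^sub>R dual_step j i))"

definition "noise j i = a *\<^sub>R (A *v X j i - b) - (1 / \<gamma>) *\<^sub>R dual_step j i"

lemma m_pos: "m > 0"
proof (rule ccontr)
  assume "\<not> m > 0"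
  then have "(\<Union>j\<in>{1..m}. S j) = {}"
    by simp
  with partition show False
    by (simp add: is_block_partition_def)
qed

lemma a_pos: "a > 0"
  using L_pos m_pos by (simp add: a_def)

lemma X_0 [simp]: "X j 0 = x0" and Y_0 [simp]: "Y j 0 = y0"
  by (simp_all add: clvr_x_def clvr_y_def)

lemma dual_step_0 [simp]: "dual_step j 0 = 0" and correction_0 [simp]: "correction j 0 = 0"
  by (simp_all add: dual_step_def correction_def)

lemma X_Suc: "X j (Suc i) = closest_point nonneg_orthant (x0 - (1 / \<gamma>) *\<^sub>R Q j i)"
  by (simp add: clvr_x_def Q_def case_prod_unfold Let_def)

lemma dual_step_Suc:
  "dual_step j (Suc i) = (\<gamma> * real m * a) *\<^sub>R subvec (A *v X j (Suc i) - b) (S (j (Suc i)))"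
  by (simp add: dual_step_def clvr_x_def clvr_y_def case_prod_unfold Let_def step_a_def a_def
      row_block_mult_vec subvec_diff)

lemma subvec_dual_step: "subvec (dual_step j (Suc i)) (S (j (Suc i))) = dual_step j (Suc i)"
  by (simp add: dual_step_Suc subvec_scaleR)

lemma Z_Suc: "Z j (Suc i) = Z j i + transpose A *v dual_step j (Suc i)"
proof -
  have "Z j (Suc i) = Z j i + transpose (row_block A (S (j (Suc i)))) *v
      subvec (dual_step j (Suc i)) (S (j (Suc i)))"
    by (simp add: Z_def dual_step_def clvr_y_def case_prod_unfold Let_def subvec_diff [symmetric])
  then show ?thesis
    by (metis transpose_row_block_mult_subvec subvec_dual_step)
qed

lemma Z_eq: "Z j i = transpose A *v Y j i"
proof (induction i)
  case 0
  then show ?case by (simp add: Z_def clvr_y_def)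
next
  case (Suc i)
  then show ?case
    by (simp add: Z_Suc dual_step_def matrix_vector_mult_diff_distrib)
qed

lemma Q_Suc:
  "Q j (Suc i) = Q j i + a *\<^sub>R (Z j (Suc i) + c) + (real m * a) *\<^sub>R (Z j (Suc i) - Z j i)"
  by (simp add: Q_def Z_def case_prod_unfold Let_def step_a_def a_def)

text \<open>
  The accumulated \<open>q\<close> is the sum of all past slopes plus a prediction of the next one that freezes
  the dual variable.
\<close>

lemma Q_eq: "Q j i = (\<Sum>l=1..i. slope j l) + a *\<^sub>R (transpose A *v Y j i + c)"
proof (induction i)
  case 0
  then show ?case by (simp add: Q_def clvr_y_def step_a_def a_def)
next
  case (Suc i)
  have "slope j (Suc i) = a *\<^sub>R (c + transpose A *v Y j i)
      + (real m * a) *\<^sub>R (transpose A *v Y j (Suc i) - transpose A *v Y j i)"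
    by (simp add: slope_def dual_step_def matrix_vector_right_distrib matrix_vector_mult_diff_distrib
        matrix_vector_mult_scaleR scaleR_right_distrib)
  then show ?case
    by (simp add: Q_Suc Suc Z_eq algebra_simps)
qed

lemma sum_slope_Suc: "(\<Sum>l=1..Suc i. slope j l) = Q j i + correction j (Suc i)"
  by (simp add: Q_eq slope_def correction_def matrix_vector_right_distrib matrix_vector_mult_scaleR
      scaleR_right_distrib)

lemma X_nonneg: "X j i \<in> nonneg_orthant"
proof (cases i)
  case (Suc n)
  have "(nonneg_orthant :: (real^'d) set) \<noteq> {}"
    using zero_in_nonneg_orthant by auto
  then show ?thesis
    unfolding Suc X_Suc by (intro closest_point_in_set closed_nonneg_orthant)
qed (simp add: x0)

text \<open>
  Variational inequality of the projection, scaled by \<open>\<gamma>\<close>.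
\<close>

lemma X_Suc_optimal:
  assumes "u \<in> nonneg_orthant"
  shows "(\<gamma> *\<^sub>R (x0 - X j (Suc i)) - Q j i) \<bullet> (u - X j (Suc i)) \<le> 0"
proof -
  have "(x0 - (1 / \<gamma>) *\<^sub>R Q j i - X j (Suc i)) \<bullet> (u - X j (Suc i)) \<le> 0"
    unfolding X_Suc by (intro closest_point_dot convex_nonneg_orthant closed_nonneg_orthant assms)
  then have "\<gamma> * ((x0 - (1 / \<gamma>) *\<^sub>R Q j i - X j (Suc i)) \<bullet> (u - X j (Suc i))) \<le> 0"
    using gamma_pos by (simp add: mult_le_0_iff)
  moreover have "\<gamma> *\<^sub>R (x0 - X j (Suc i)) - Q j i = \<gamma> *\<^sub>R (x0 - (1 / \<gamma>) *\<^sub>R Q j i - X j (Suc i))"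
    using gamma_pos by (simp add: algebra_simps)
  ultimately show ?thesis by simp
qed

lemma X_Suc_three_point:
  assumes "u \<in> nonneg_orthant"
  shows "Q j i \<bullet> (X j (Suc i) - u)
    \<le> \<gamma> / 2 * ((norm (u - x0))\<^sup>2 - (norm (u - X j (Suc i)))\<^sup>2 - (norm (X j (Suc i) - x0))\<^sup>2)"
proof -
  define x where "x = X j (Suc i)"
  have "Q j i \<bullet> (x - u) \<le> \<gamma> * ((x - x0) \<bullet> (u - x))"
    using X_Suc_optimal [OF assms, of j i]
    by (simp add: x_def inner_diff_left inner_diff_right algebra_simps)
  also have "(x - x0) \<bullet> (u - x) = ((norm (u - x0))\<^sup>2 - (norm (u - x))\<^sup>2 - (norm (x - x0))\<^sup>2) / 2"
    by (simp add: power2_norm_eq_inner inner_diff_left inner_diff_right inner_commute algebra_simps)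
  finally show ?thesis by (simp add: x_def)
qed

text \<open>
  Regret of optimistic dual averaging. The induction step applies the hypothesis at the comparison point
  \<open>x\<^sub>k\<^sub>+\<^sub>1\<close> and moves from there to \<open>u\<close> by the optimality of \<open>x\<^sub>k\<^sub>+\<^sub>1\<close>. The error of the previous
  prediction is then paired with \<open>x\<^sub>k - x\<^sub>k\<^sub>+\<^sub>1\<close> and absorbed by the quadratic term between these two points.
\<close>

lemma primal_regret:
  assumes "u \<in> nonneg_orthant"
  shows "(\<Sum>i=1..k. slope j i \<bullet> (X j i - u))
    \<le> \<gamma> / 2 * ((norm (u - x0))\<^sup>2 - (norm (u - X j k))\<^sup>2) + correction j k \<bullet> (X j k - u)
      + (\<Sum>i=1..k. (norm (correction j (i - 1)))\<^sup>2) / (2 * \<gamma>)"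
  using assms
proof (induction k arbitrary: u)
  case 0
  then show ?case by simp
next
  case (Suc k)
  define x where "x = X j (Suc k)"
  have "(\<Sum>i=1..Suc k. slope j i \<bullet> (X j i - u))
      = (\<Sum>i=1..k. slope j i \<bullet> (X j i - x)) + (\<Sum>i=1..Suc k. slope j i) \<bullet> (x - u)"
    by (simp add: x_def inner_sum_left inner_diff_right inner_add_left sum_subtractf algebra_simps)
  also have "(\<Sum>i=1..Suc k. slope j i) \<bullet> (x - u) = Q j k \<bullet> (x - u) + correction j (Suc k) \<bullet> (x - u)"
    by (simp only: sum_slope_Suc inner_add_left)
  finally have split: "(\<Sum>i=1..Suc k. slope j i \<bullet> (X j i - u))
      = (\<Sum>i=1..k. slope j i \<bullet> (X j i - x)) + (Q j k \<bullet> (x - u) + correction j (Suc k) \<bullet> (x - u))" .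
  have IH: "(\<Sum>i=1..k. slope j i \<bullet> (X j i - x))
      \<le> \<gamma> / 2 * ((norm (x - x0))\<^sup>2 - (norm (x - X j k))\<^sup>2) + correction j k \<bullet> (X j k - x)
      + (\<Sum>i=1..k. (norm (correction j (i - 1)))\<^sup>2) / (2 * \<gamma>)"
    unfolding x_def by (rule Suc.IH) (rule X_nonneg)
  have three: "Q j k \<bullet> (x - u)
      \<le> \<gamma> / 2 * ((norm (u - x0))\<^sup>2 - (norm (u - x))\<^sup>2 - (norm (x - x0))\<^sup>2)"
    unfolding x_def by (rule X_Suc_three_point) fact
  have young: "correction j k \<bullet> (X j k - x) \<le> (norm (correction j k))\<^sup>2 / (2 * \<gamma>) + \<gamma> / 2 * (norm (x - X j k))\<^sup>2"
    using inner_le_weighted_squares [OF gamma_pos, of "correction j k" "X j k - x"] by (simp add: norm_minus_commute)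
  have sum: "(\<Sum>i=1..Suc k. (norm (correction j (i - 1)))\<^sup>2) / (2 * \<gamma>)
      = (\<Sum>i=1..k. (norm (correction j (i - 1)))\<^sup>2) / (2 * \<gamma>) + (norm (correction j k))\<^sup>2 / (2 * \<gamma>)"
    by (simp add: add_divide_distrib)
  show ?case
    unfolding split sum x_def [symmetric] using IH three young by (simp add: right_diff_distrib)
qed

text \<open>
  Each dual step satisfies the identity
  \<open>\<parallel>v - y\<^sub>i\<^sub>-\<^sub>1\<parallel>\<^sup>2 - \<parallel>v - y\<^sub>i\<parallel>\<^sup>2 = 2 (v - y\<^sub>i\<^sub>-\<^sub>1) \<bullet> d - \<parallel>d\<parallel>\<^sup>2\<close> with \<open>d = y\<^sub>i - y\<^sub>i\<^sub>-\<^sub>1\<close>, and the extrapolation by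
  \<open>m d\<close> contributes exactly another \<open>- 2 \<parallel>d\<parallel>\<^sup>2\<close>, because \<open>d\<close> is \<open>\<gamma> m a\<close> times the drawn block of the residual.
\<close>

lemma dual_regret:
  "(\<Sum>i=1..k. a * ((v - (Y j (i - 1) + real m *\<^sub>R dual_step j i)) \<bullet> (A *v X j i - b)))
    = ((norm (v - y0))\<^sup>2 - (norm (v - Y j k))\<^sup>2) / (2 * \<gamma>)
      - (\<Sum>i=1..k. (norm (dual_step j i))\<^sup>2) / (2 * \<gamma>)
      + (\<Sum>i=1..k. (v - Y j (i - 1)) \<bullet> noise j i)"
proof (induction k)
  case 0
  then show ?case by simp
next
  case (Suc k)
  define d where "d = dual_step j (Suc k)"
  define r where "r = A *v X j (Suc k) - b"
  define p where "p = v - Y j k"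
  have Y: "v - Y j (Suc k) = p - d"
    by (simp add: p_def d_def dual_step_def)
  have "(norm d)\<^sup>2 = (\<gamma> * real m * a) * (d \<bullet> r)"
  proof -
    have "d \<bullet> r = subvec d (S (j (Suc k))) \<bullet> subvec r (S (j (Suc k)))"
      by (metis d_def inner_subvec subvec_dual_step)
    also have "\<dots> = d \<bullet> subvec r (S (j (Suc k)))"
      by (simp only: d_def subvec_dual_step)
    finally show ?thesis
      by (metis d_def dual_step_Suc inner_scaleR_right power2_norm_eq_inner r_def)
  qed
  then have d: "real m * a * (d \<bullet> r) = (norm d)\<^sup>2 / \<gamma>"
    using gamma_pos by (simp add: field_simps)
  have "a * ((v - (Y j k + real m *\<^sub>R d)) \<bullet> r) = a * (p \<bullet> r) - real m * a * (d \<bullet> r)"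
    by (simp add: p_def inner_diff_left inner_add_left algebra_simps)
  also have "\<dots> = ((norm p)\<^sup>2 - (norm (p - d))\<^sup>2) / (2 * \<gamma>) - (norm d)\<^sup>2 / (2 * \<gamma>) + p \<bullet> noise j (Suc k)"
    unfolding d using gamma_pos
    by (simp add: noise_def d_def [symmetric] r_def [symmetric] inner_diff_right inner_diff_left
        power2_norm_eq_inner inner_commute field_simps)
  finally have "a * ((v - (Y j k + real m *\<^sub>R d)) \<bullet> r)
    = ((norm p)\<^sup>2 - (norm (p - d))\<^sup>2) / (2 * \<gamma>) - (norm d)\<^sup>2 / (2 * \<gamma>) + p \<bullet> noise j (Suc k)" .
  then show ?case
    using Suc by (simp add: d_def [symmetric] r_def [symmetric] p_def [symmetric] Y
        add_divide_distrib diff_divide_distrib)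
qed


text \<open>
  A dual step is supported on one block, so only the norm of that block matters, and the step size gives
  \<open>m a L = 1 / 2\<close>.
\<close>

lemma norm_correction_le:
  assumes "i \<ge> 1 \<Longrightarrow> j i \<in> {1..m}"
  shows "norm (correction j i) \<le> norm (dual_step j i) / 2"
proof (cases i)
  case (Suc n)
  define B where "B = row_block A (S (j i))"
  have "transpose A *v dual_step j i = transpose B *v dual_step j i"
    unfolding Suc B_def by (metis transpose_row_block_mult_subvec subvec_dual_step)
  then have "norm (transpose A *v dual_step j i) \<le> onorm ((*v) B) * norm (dual_step j i)"
    by (simp only: norm_transpose_mult_le)
  also have "onorm ((*v) B) \<le> L"
    unfolding Lhat_def B_def using assms Suc by (intro Max_ge) auto
  finally have "norm (transpose A *v dual_step j i) \<le> L * norm (dual_step j i)"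
    by (simp add: mult_right_mono)
  then have "real m * a * norm (transpose A *v dual_step j i)
      \<le> real m * a * (L * norm (dual_step j i))"
    using a_pos by (intro mult_left_mono) auto
  also have "\<dots> = norm (dual_step j i) / 2"
    using L_pos m_pos by (simp add: a_def)
  finally show ?thesis
    using a_pos by (simp add: correction_def)
qed simp

abbreviation "out \<equiv> clvr_output A b c S m \<gamma> x0 y0"

definition "dual_path j k = (\<Sum>i=1..k. (norm (dual_step j i))\<^sup>2)"

lemma dual_path_ge: "(norm (dual_step j k))\<^sup>2 \<le> dual_path j k"
  by (cases k) (simp_all add: dual_path_def sum_nonneg)

text \<open>
  The last dual step does not occur among the shifted corrections. The term gained here helps to pay for the last
  correction, which appears separately in the regret.
\<close>

lemma sum_norm_correction_le:
  assumes "\<And>i. i \<in> {1..k} \<Longrightarrow> j i \<in> {1..m}"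
  shows "(\<Sum>i=1..k. (norm (correction j (i - 1)))\<^sup>2)
    \<le> (dual_path j k - (norm (dual_step j k))\<^sup>2) / 4"
  using assms
proof (induction k)
  case 0
  then show ?case by (simp add: dual_path_def)
next
  case (Suc k)
  have "norm (correction j k) \<le> norm (dual_step j k) / 2"
    by (rule norm_correction_le) (use Suc.prems in auto)
  then have "(norm (correction j k))\<^sup>2 \<le> (norm (dual_step j k) / 2)\<^sup>2"
    by (intro power_mono) auto
  moreover have "(\<Sum>i=1..k. (norm (correction j (i - 1)))\<^sup>2)
    \<le> (dual_path j k - (norm (dual_step j k))\<^sup>2) / 4"
    by (rule Suc.IH) (use Suc.prems in auto)
  ultimately show ?case
    by (simp add: dual_path_def power_divide)
qed

lemma step_A_eq: "step_A A S m k = real k * a"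
  by (simp add: step_A_def a_def)

text \<open>
  Both output components are averages with weights \<open>a\<close>: the primal one of the \<open>x\<^sub>i\<close>, the dual one of the
  extrapolated points.
\<close>

lemma scaled_output:
  assumes "k \<ge> 1"
  shows "(real k * a) *\<^sub>R fst (out j k) = (\<Sum>i=1..k. a *\<^sub>R X j i)"
    and "(real k * a) *\<^sub>R snd (out j k)
      = (\<Sum>i=1..k. a *\<^sub>R (Y j (i - 1) + real m *\<^sub>R dual_step j i))"
proof -
  have "real k * a \<noteq> 0"
    using assms a_pos by simp
  moreover have "a *\<^sub>R Y j i + ((real m - 1) * a) *\<^sub>R (Y j i - Y j (i - 1))
      = a *\<^sub>R (Y j (i - 1) + real m *\<^sub>R dual_step j i)" for i
    by (simp add: dual_step_def algebra_simps)
  ultimately show "(real k * a) *\<^sub>R fst (out j k) = (\<Sum>i=1..k. a *\<^sub>R X j i)"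
    "(real k * a) *\<^sub>R snd (out j k)
      = (\<Sum>i=1..k. a *\<^sub>R (Y j (i - 1) + real m *\<^sub>R dual_step j i))"
    unfolding clvr_output_def step_A_eq by (simp_all add: step_a_def a_def [symmetric])
qed

lemma output_nonneg: "fst (out j k) \<in> nonneg_orthant"
  unfolding clvr_output_def step_A_eq fst_conv using a_pos
  by (intro nonneg_orthant_scaleR nonneg_orthant_sum X_nonneg)
    (auto simp: step_a_def a_def [symmetric])

lemma sum_const_scaleR: "(\<Sum>i=1..k. a *\<^sub>R v) = (real k * a) *\<^sub>R v" for v :: "'v::real_vector"
  by (simp only: sum_constant_scaleR card_atLeastAtMost) simp

lemma sum_slope_eq:
  assumes "k \<ge> 1"
  shows "(\<Sum>i=1..k. slope j i) = (real k * a) *\<^sub>R (c + transpose A *v snd (out j k))"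
proof -
  define V where "V i = Y j (i - 1) + real m *\<^sub>R dual_step j i" for i
  have "slope j i = a *\<^sub>R c + transpose A *v (a *\<^sub>R V i)" for i
    by (simp only: slope_def V_def scaleR_right_distrib matrix_vector_mult_scaleR
        matrix_vector_right_distrib)
  then have "(\<Sum>i=1..k. slope j i) = (\<Sum>i=1..k. a *\<^sub>R c) + transpose A *v (\<Sum>i=1..k. a *\<^sub>R V i)"
    by (simp only: sum.distrib linear_sum [OF matrix_vector_mul_linear])
  then show ?thesis
    unfolding sum_const_scaleR V_def scaled_output(2) [OF assms, symmetric]
    by (simp only: matrix_vector_mult_scaleR scaleR_right_distrib)
qed

lemma sum_residual_eq:
  assumes "k \<ge> 1"
  shows "(\<Sum>i=1..k. a *\<^sub>R (A *v X j i - b)) = (real k * a) *\<^sub>R (A *v fst (out j k) - b)"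
proof -
  have "(\<Sum>i=1..k. a *\<^sub>R (A *v X j i - b)) = A *v (\<Sum>i=1..k. a *\<^sub>R X j i) - (\<Sum>i=1..k. a *\<^sub>R b)"
    by (simp only: scaleR_right_diff_distrib sum_subtractf matrix_vector_mult_scaleR [symmetric]
        linear_sum [OF matrix_vector_mul_linear])
  then show ?thesis
    unfolding sum_const_scaleR scaled_output(1) [OF assms, symmetric]
    by (simp only: matrix_vector_mult_scaleR scaleR_right_diff_distrib)
qed

text \<open>
  The Lagrangian is affine in each variable, so the gap of the averages is the average of the gaps, and
  the gap at \<open>x\<^sub>i\<close> and the extrapolated dual point is exactly linearized by the two partial gradients there.
\<close>

lemma gap_eq:
  assumes "k \<ge> 1"
  shows "real k * a * (lagrangian A b c (fst (out j k)) v - lagrangian A b c u (snd (out j k)))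
    = (\<Sum>i=1..k. slope j i \<bullet> (X j i - u))
    + (\<Sum>i=1..k. a * ((v - (Y j (i - 1) + real m *\<^sub>R dual_step j i)) \<bullet> (A *v X j i - b)))"
proof -
  define xt where "xt = fst (out j k)"
  define yt where "yt = snd (out j k)"
  define V where "V i = Y j (i - 1) + real m *\<^sub>R dual_step j i" for i
  have "slope j i \<bullet> (X j i - u) + a * ((v - V i) \<bullet> (A *v X j i - b))
      = c \<bullet> (a *\<^sub>R X j i) - slope j i \<bullet> u + v \<bullet> (a *\<^sub>R (A *v X j i - b)) + (a *\<^sub>R V i) \<bullet> b" for i
  proof -
    have "slope j i \<bullet> X j i = a * (c \<bullet> X j i + V i \<bullet> (A *v X j i))"
      by (simp add: slope_def V_def inner_add_left inner_transpose_left)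
    then show ?thesis
      by (simp add: inner_diff_left inner_diff_right algebra_simps)
  qed
  then have "(\<Sum>i=1..k. slope j i \<bullet> (X j i - u)) + (\<Sum>i=1..k. a * ((v - V i) \<bullet> (A *v X j i - b)))
    = c \<bullet> (\<Sum>i=1..k. a *\<^sub>R X j i) - (\<Sum>i=1..k. slope j i) \<bullet> u
      + v \<bullet> (\<Sum>i=1..k. a *\<^sub>R (A *v X j i - b)) + (\<Sum>i=1..k. a *\<^sub>R V i) \<bullet> b"
    by (simp only: sum.distrib [symmetric] sum_subtractf [symmetric] inner_sum_left inner_sum_right)
  also have "\<dots> = real k * a * (c \<bullet> xt - (c + transpose A *v yt) \<bullet> u + v \<bullet> (A *v xt - b) + yt \<bullet> b)"
    unfolding sum_slope_eq [OF assms] sum_residual_eq [OF assms] V_def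
      scaled_output [OF assms, symmetric] xt_def yt_def
    by (simp add: algebra_simps)
  also have "(c + transpose A *v yt) \<bullet> u = c \<bullet> u + yt \<bullet> (A *v u)"
    by (simp add: inner_add_left inner_transpose_left)
  finally show ?thesis
    unfolding V_def xt_def [symmetric] yt_def [symmetric]
    by (simp add: lagrangian_def inner_diff_right algebra_simps)
qed

lemma gap_le:
  assumes k: "k \<ge> 1" and j: "\<And>i. i \<in> {1..k} \<Longrightarrow> j i \<in> {1..m}" and u: "u \<in> nonneg_orthant"
  shows "real k * a * (lagrangian A b c (fst (out j k)) v - lagrangian A b c u (snd (out j k)))
    \<le> \<gamma> / 2 * ((norm (u - x0))\<^sup>2 - (norm (u - X j k))\<^sup>2)
      + ((norm (v - y0))\<^sup>2 - (norm (v - Y j k))\<^sup>2) / (2 * \<gamma>)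
      + norm (dual_step j k) * norm (X j k - u) / 2
      - (3 * dual_path j k + (norm (dual_step j k))\<^sup>2) / (8 * \<gamma>)
      + (\<Sum>i=1..k. (v - Y j (i - 1)) \<bullet> noise j i)"
proof -
  have "norm (correction j k) \<le> norm (dual_step j k) / 2"
    by (rule norm_correction_le) (use j in auto)
  then have "correction j k \<bullet> (X j k - u) \<le> norm (dual_step j k) / 2 * norm (X j k - u)"
    by (intro order.trans [OF norm_cauchy_schwarz] mult_right_mono) auto
  moreover have "(\<Sum>i=1..k. (norm (correction j (i - 1)))\<^sup>2) / (2 * \<gamma>)
      \<le> (dual_path j k - (norm (dual_step j k))\<^sup>2) / 4 / (2 * \<gamma>)"
    using gamma_pos sum_norm_correction_le [OF j] by (intro divide_right_mono) auto
  moreover have "(dual_path j k - (norm (dual_step j k))\<^sup>2) / 4 / (2 * \<gamma>) - dual_path j k / (2 * \<gamma>)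
      = - ((3 * dual_path j k + (norm (dual_step j k))\<^sup>2) / (8 * \<gamma>))"
    using gamma_pos by (simp add: field_simps)
  ultimately show ?thesis
    using primal_regret [OF u, where j = j and k = k]
    unfolding gap_eq [OF k] dual_regret dual_path_def [symmetric] by linarith
qed


section \<open>Pathwise bounds on the metric\<close>

definition "total_noise j k = (\<Sum>i=1..k. noise j i)"

definition "noise_pairing v j k = (\<Sum>i=1..k. (v - Y j (i - 1)) \<bullet> noise j i)"

lemma noise_pairing_shift: "noise_pairing 0 j k = noise_pairing v j k - v \<bullet> total_noise j k"
  by (simp add: noise_pairing_def total_noise_def inner_sum_right sum_subtractf [symmetric]
      inner_diff_left)

lemma dual_path_nonneg: "0 \<le> dual_path j k"
  by (simp add: dual_path_def sum_nonneg)

text \<open>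
  The gap at a solution is nonnegative. The cross term with the last correction is split so that half of
  the quadratic term in \<open>x\<close> and part of the path term survive.
\<close>

lemma energy_le:
  assumes k: "k \<ge> 1" and j: "\<And>i. i \<in> {1..k} \<Longrightarrow> j i \<in> {1..m}"
    and sol: "ws \<in> primal_dual_solutions A b c"
  shows "(weighted_norm \<gamma> ((X j k, Y j k) - ws))\<^sup>2 + dual_path j k / \<gamma>
    \<le> 4 * ((weighted_norm \<gamma> ((x0, y0) - ws))\<^sup>2 / 2 + noise_pairing (snd ws) j k)"
proof -
  obtain xs ys where ws: "ws = (xs, ys)" by (cases ws)
  have xs: "xs \<in> nonneg_orthant"
    and saddle: "\<And>x y. x \<in> nonneg_orthant \<Longrightarrow>
      lagrangian A b c xs y \<le> lagrangian A b c xs ys \<and> lagrangian A b c xs ys \<le> lagrangian A b c x ys"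
    using sol by (auto simp: ws primal_dual_solutions_def)
  have "lagrangian A b c xs (snd (out j k)) \<le> lagrangian A b c (fst (out j k)) ys"
    using saddle [OF output_nonneg] by (meson order.trans)
  then have "0 \<le> real k * a * (lagrangian A b c (fst (out j k)) ys - lagrangian A b c xs (snd (out j k)))"
    using a_pos by simp
  also note gap_le [OF k j xs]
  finally have gap: "0 \<le> \<gamma> / 2 * ((norm (xs - x0))\<^sup>2 - (norm (xs - X j k))\<^sup>2)
      + ((norm (ys - y0))\<^sup>2 - (norm (ys - Y j k))\<^sup>2) / (2 * \<gamma>)
      + norm (dual_step j k) * norm (X j k - xs) / 2
      - (3 * dual_path j k + (norm (dual_step j k))\<^sup>2) / (8 * \<gamma>) + noise_pairing ys j k"
    by (simp only: noise_pairing_def)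
  define d where "d = norm (dual_step j k)"
  define p where "p = norm (X j k - xs)"
  define q where "q = norm (Y j k - ys)"
  define P where "P = dual_path j k"
  define D2 where "D2 = \<gamma> * (norm (x0 - xs))\<^sup>2 + (norm (y0 - ys))\<^sup>2 / \<gamma>"
  have "d * p / 2 \<le> d\<^sup>2 / (4 * \<gamma>) + \<gamma> / 4 * p\<^sup>2"
    using inner_le_weighted_squares [OF gamma_pos, of d p] by simp
  moreover have "d\<^sup>2 / (4 * \<gamma>) \<le> P / (8 * \<gamma>) + d\<^sup>2 / (8 * \<gamma>)"
    using dual_path_ge [of j k] gamma_pos by (simp add: d_def P_def field_simps)
  moreover have "0 \<le> D2 / 2 - \<gamma> / 2 * p\<^sup>2 - q\<^sup>2 / \<gamma> / 2 + d * p / 2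
      - 3 * (P / (8 * \<gamma>)) - d\<^sup>2 / (8 * \<gamma>) + noise_pairing ys j k"
    using gap unfolding d_def p_def q_def P_def D2_def
    by (simp add: norm_minus_commute add_divide_distrib diff_divide_distrib algebra_simps)
  moreover have "q\<^sup>2 / \<gamma> \<ge> 0" "P / \<gamma> \<ge> 0"
    using gamma_pos dual_path_nonneg by (auto simp: P_def)
  ultimately have "\<gamma> * p\<^sup>2 + q\<^sup>2 / \<gamma> + P / \<gamma> \<le> 4 * (D2 / 2 + noise_pairing ys j k)"
    by (simp add: field_simps)
  then show ?thesis
    by (simp add: weighted_norm_sq [OF gamma_pos] ws p_def q_def P_def D2_def)
qed

text \<open>
  Dividing the dual steps by \<open>\<gamma>\<close> and adding the noise gives the primal residuals, and the dual steps
  telescope.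
\<close>

lemma primal_residual_le:
  assumes "k \<ge> 1"
  shows "real k * a * norm (A *v fst (out j k) - b)
    \<le> 1 / sqrt \<gamma> * (weighted_norm \<gamma> ((X j k, Y j k) - (x0, y0)) + sqrt \<gamma> * norm (total_noise j k))"
proof -
  have "(\<Sum>i=1..k. dual_step j i) = Y j k - y0"
    by (induction k) (simp_all add: dual_step_def)
  then have "(real k * a) *\<^sub>R (A *v fst (out j k) - b) = (1 / \<gamma>) *\<^sub>R (Y j k - y0) + total_noise j k"
    by (simp add: sum_residual_eq [OF assms, symmetric] total_noise_def noise_def sum_subtractf
        scaleR_sum_right [symmetric])
  then have "norm ((real k * a) *\<^sub>R (A *v fst (out j k) - b)) \<le> norm (Y j k - y0) / \<gamma> + norm (total_noise j k)"
    using gamma_pos norm_triangle_ineq [of "(1 / \<gamma>) *\<^sub>R (Y j k - y0)" "total_noise j k"] by simp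
  also have "norm (Y j k - y0) / \<gamma> = 1 / sqrt \<gamma> * (norm (Y j k - y0) / sqrt \<gamma>)"
    using gamma_pos by (simp add: field_simps)
  also have "\<dots> \<le> 1 / sqrt \<gamma> * weighted_norm \<gamma> ((X j k, Y j k) - (x0, y0))"
    using norm_snd_le_weighted_norm [OF gamma_pos, of "(X j k, Y j k) - (x0, y0)"] gamma_pos
    by (intro mult_left_mono) auto
  finally show ?thesis
    using a_pos gamma_pos by (simp add: distrib_left)
qed

text \<open>
  The accumulated slope is \<open>Q + correction\<close>, and the projection onto the orthant dominates the projected
  vector: \<open>- Q \<le> \<gamma> (x\<^sub>k - x\<^sub>0)\<close> in every coordinate.
\<close>

lemma dual_residual_le:
  assumes k: "k \<ge> 1" and j: "\<And>i. i \<in> {1..k} \<Longrightarrow> j i \<in> {1..m}"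
  shows "real k * a * norm (pos_part (- (transpose A *v snd (out j k)) - c))
    \<le> sqrt \<gamma> * (weighted_norm \<gamma> ((X j k, Y j k) - (x0, y0)) + norm (dual_step j k) / sqrt \<gamma> / 2)"
proof -
  obtain n where n: "k = Suc n" using k by (cases k) auto
  define v where "v = - (transpose A *v snd (out j k)) - c"
  define r where "r = real k * a"
  have r: "r > 0" using k a_pos by (simp add: r_def)
  have v: "r *\<^sub>R v = - Q j n - correction j k"
    using sum_slope_eq [OF k, of j] sum_slope_Suc [of j n]
    by (simp add: v_def r_def n algebra_simps)
  have "(\<gamma> *\<^sub>R (x0 - X j k) - Q j n) $ p \<le> 0" for p
  proof -
    \<comment> \<open>increasing a coordinate stays feasible, so the variational inequality holds in that coordinate\<close>
    have "X j k + axis p 1 \<in> nonneg_orthant"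
      using X_nonneg [of j k] by (auto simp: nonneg_orthant_def axis_def)
    from X_Suc_optimal [OF this, of j n] show ?thesis
      by (simp add: n inner_axis)
  qed
  then have "(r *\<^sub>R v) $ p \<le> (\<gamma> *\<^sub>R (X j k - x0) - correction j k) $ p" for p
    unfolding v by (simp add: algebra_simps)
  then have "norm (pos_part (r *\<^sub>R v)) \<le> norm (\<gamma> *\<^sub>R (X j k - x0) - correction j k)"
    by (rule norm_pos_part_le)
  also have "\<dots> \<le> \<gamma> * norm (X j k - x0) + norm (correction j k)"
    using norm_triangle_ineq4 [of "\<gamma> *\<^sub>R (X j k - x0)" "correction j k"] gamma_pos by simp
  also have "norm (correction j k) \<le> norm (dual_step j k) / 2"
    by (rule norm_correction_le) (use j in auto)
  also have "\<gamma> * norm (X j k - x0) = sqrt \<gamma> * (sqrt \<gamma> * norm (X j k - x0))"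
    using gamma_pos by simp
  also have "sqrt \<gamma> * (sqrt \<gamma> * norm (X j k - x0)) \<le> sqrt \<gamma> * weighted_norm \<gamma> ((X j k, Y j k) - (x0, y0))"
    using norm_fst_le_weighted_norm [OF gamma_pos, of "(X j k, Y j k) - (x0, y0)"] gamma_pos
    by (intro mult_left_mono) auto
  also have "pos_part (r *\<^sub>R v) = r *\<^sub>R pos_part v"
    using r by (auto simp: vec_eq_iff pos_part_def max_def zero_le_mult_iff mult_le_0_iff)
  finally show ?thesis
    using r gamma_pos by (simp add: r_def v_def distrib_left)
qed

text \<open>
  The gap at the origin contains \<open>\<parallel>w\<^sub>0\<parallel>\<^sup>2 - \<parallel>w\<^sub>k\<parallel>\<^sup>2\<close>. Expanding both squares around \<open>ws\<close> leaves terms linear in \<open>ws\<close> and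
  the difference of the squared distances to \<open>ws\<close>. The negative one of
  these, together with the path term, absorbs the last correction up to a term linear in \<open>ws\<close>.
\<close>

lemma objective_gap_le:
  assumes k: "k \<ge> 1" and j: "\<And>i. i \<in> {1..k} \<Longrightarrow> j i \<in> {1..m}"
  shows "real k * a * (c \<bullet> fst (out j k) + b \<bullet> snd (out j k))
    \<le> weighted_norm \<gamma> ws * (weighted_norm \<gamma> ((x0, y0) - ws) + weighted_norm \<gamma> ((X j k, Y j k) - ws)
        + norm (dual_step j k) / sqrt \<gamma> / 2 + sqrt \<gamma> * norm (total_noise j k))
      + (weighted_norm \<gamma> ((x0, y0) - ws))\<^sup>2 / 2 + noise_pairing (snd ws) j k"
proof -
  obtain xs ys where ws: "ws = (xs, ys)" by (cases ws)
  define wk where "wk = (X j k, Y j k)"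
  define d where "d = norm (dual_step j k)"
  define p where "p = norm (X j k - xs)"
  have "real k * a * (c \<bullet> fst (out j k) + b \<bullet> snd (out j k))
    = real k * a * (lagrangian A b c (fst (out j k)) 0 - lagrangian A b c 0 (snd (out j k)))"
    by (simp add: lagrangian_def inner_commute)
  also have "\<dots> \<le> ((weighted_norm \<gamma> (x0, y0))\<^sup>2 - (weighted_norm \<gamma> wk)\<^sup>2) / 2
      + d * norm (X j k) / 2 - (3 * dual_path j k + d\<^sup>2) / (8 * \<gamma>) + noise_pairing 0 j k"
    using gap_le [OF k j zero_in_nonneg_orthant, where v = 0]
    by (simp add: d_def noise_pairing_def weighted_norm_sq [OF gamma_pos] wk_def
        add_divide_distrib diff_divide_distrib algebra_simps)
  also have "\<dots> \<le> ((weighted_norm \<gamma> (x0, y0))\<^sup>2 - (weighted_norm \<gamma> wk)\<^sup>2) / 2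
      + d * norm (X j k) / 2 - d\<^sup>2 / (8 * \<gamma>) + noise_pairing 0 j k"
    using gamma_pos dual_path_nonneg [of j k] by (simp add: add_divide_distrib)
  also have "d * norm (X j k) / 2 \<le> d * norm xs / 2 + d * p / 2"
  proof -
    have "norm (X j k) \<le> norm xs + p"
      using norm_triangle_ineq [of xs "X j k - xs"] by (simp add: p_def)
    then have "d * norm (X j k) \<le> d * (norm xs + p)"
      by (intro mult_left_mono) (auto simp: d_def)
    then show ?thesis by (simp add: distrib_left)
  qed
  also have "d * p / 2 \<le> d\<^sup>2 / (8 * \<gamma>) + \<gamma> / 2 * p\<^sup>2"
    using inner_le_weighted_squares [of "2 * \<gamma>" d p] gamma_pos by simp
  also have "\<gamma> / 2 * p\<^sup>2 \<le> (weighted_norm \<gamma> (wk - ws))\<^sup>2 / 2"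
    using gamma_pos by (simp add: weighted_norm_sq [OF gamma_pos] ws wk_def p_def)
  also have "d * norm xs / 2 = d / sqrt \<gamma> / 2 * (sqrt \<gamma> * norm xs)"
    using gamma_pos by simp
  also have "\<dots> \<le> d / sqrt \<gamma> / 2 * weighted_norm \<gamma> ws"
    using norm_fst_le_weighted_norm [OF gamma_pos, of ws] gamma_pos
    by (intro mult_left_mono) (auto simp: ws d_def)
  also have "noise_pairing 0 j k \<le> noise_pairing ys j k + weighted_norm \<gamma> ws * (sqrt \<gamma> * norm (total_noise j k))"
  proof -
    have "- (ys \<bullet> total_noise j k) \<le> norm ys * norm (total_noise j k)"
      using norm_cauchy_schwarz [of "- ys" "total_noise j k"] by simp
    also have "\<dots> = norm ys / sqrt \<gamma> * (sqrt \<gamma> * norm (total_noise j k))"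
      using gamma_pos by simp
    also have "\<dots> \<le> weighted_norm \<gamma> ws * (sqrt \<gamma> * norm (total_noise j k))"
      using norm_snd_le_weighted_norm [OF gamma_pos, of ws] gamma_pos
      by (intro mult_right_mono) (auto simp: ws)
    finally show ?thesis
      using noise_pairing_shift [of j k ys] by simp
  qed
  finally show ?thesis
    using weighted_norm_sq_diff_le [OF gamma_pos, of "(x0, y0)" wk ws]
    by (simp add: wk_def [symmetric] d_def [symmetric] ws diff_divide_distrib algebra_simps)
qed


text \<open>
  By \<open>energy_le\<close>, \<open>sqrt (4 W)\<close> bounds both the distance of the last iterate to the solution and the last
  dual step; the triangle inequality through the solution gives the distance to the starting point. The
  objective gap enters through its positive part, for which \<open>W \<ge> 0\<close> is essential.
\<close>

lemma lp_metric_le: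
  assumes k: "k \<ge> 1" and j: "\<And>i. i \<in> {1..k} \<Longrightarrow> j i \<in> {1..m}"
    and sol: "ws \<in> primal_dual_solutions A b c"
  defines "D \<equiv> weighted_norm \<gamma> ((x0, y0) - ws)"
  defines "W \<equiv> D\<^sup>2 / 2 + noise_pairing (snd ws) j k"
  shows "real k * a * lp_metric A b c (out j k)
    \<le> (sqrt \<gamma> + 1 / sqrt \<gamma> + weighted_norm \<gamma> ws)
        * (D + (3 / 2 * sqrt (4 * W) + sqrt \<gamma> * norm (total_noise j k))) + W"
proof -
  define r where "r = real k * a"
  define U where "U = sqrt (4 * W)"
  define T where "T = sqrt \<gamma> * norm (total_noise j k)"
  define e where "e = norm (dual_step j k) / sqrt \<gamma>"
  define w where "w = weighted_norm \<gamma> ws"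
  define R where "R = D + (3 / 2 * U + T)"
  define p1 where "p1 = norm (A *v fst (out j k) - b)"
  define p2 where "p2 = norm (pos_part (- (transpose A *v snd (out j k)) - c))"
  define p3 where "p3 = max (c \<bullet> fst (out j k) + b \<bullet> snd (out j k)) 0"
  have r: "r > 0" using k a_pos by (simp add: r_def)
  have energy: "(weighted_norm \<gamma> ((X j k, Y j k) - ws))\<^sup>2 + dual_path j k / \<gamma> \<le> 4 * W"
    unfolding W_def D_def by (rule energy_le [OF k j sol])
  have path: "0 \<le> dual_path j k / \<gamma>"
    using dual_path_nonneg gamma_pos by simp
  have wk: "weighted_norm \<gamma> ((X j k, Y j k) - ws) \<le> U"
    unfolding U_def using energy path by (intro real_le_rsqrt) linarith
  have "e\<^sup>2 = (norm (dual_step j k))\<^sup>2 / \<gamma>"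
    using gamma_pos by (simp add: e_def power_divide)
  also have "\<dots> \<le> dual_path j k / \<gamma>"
    using dual_path_ge gamma_pos by (simp add: divide_right_mono)
  also have "\<dots> \<le> 4 * W"
    using energy zero_le_power2 [of "weighted_norm \<gamma> ((X j k, Y j k) - ws)"] by linarith
  finally have e: "e \<le> U"
    unfolding U_def by (rule real_le_rsqrt)
  have W: "0 \<le> W"
    using energy path zero_le_power2 [of "weighted_norm \<gamma> ((X j k, Y j k) - ws)"] by linarith
  have nonneg: "0 \<le> U" "0 \<le> T" "0 \<le> D" "0 \<le> w" "0 \<le> e"
    using W gamma_pos by (simp_all add: U_def T_def D_def w_def e_def weighted_norm_eq)
  have move: "weighted_norm \<gamma> ((X j k, Y j k) - (x0, y0)) \<le> U + D"
    using weighted_norm_triangle [OF gamma_pos, of "(X j k, Y j k)" "(x0, y0)" ws] wk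
    by (simp add: D_def)
  have b1: "r * p1 \<le> 1 / sqrt \<gamma> * R"
    unfolding r_def p1_def using move nonneg gamma_pos
    by (intro order.trans [OF primal_residual_le [OF k]] mult_left_mono)
      (auto simp: R_def T_def [symmetric])
  have b2: "r * p2 \<le> sqrt \<gamma> * R"
    unfolding r_def p2_def using move nonneg e gamma_pos
    by (intro order.trans [OF dual_residual_le [OF k j]] mult_left_mono)
      (auto simp: R_def e_def [symmetric])
  have "r * (c \<bullet> fst (out j k) + b \<bullet> snd (out j k))
      \<le> w * (D + weighted_norm \<gamma> ((X j k, Y j k) - ws) + e / 2 + T) + W"
    using objective_gap_le [OF k j, where ws = ws]
    by (simp add: r_def w_def D_def e_def T_def W_def add.assoc)
  also have "w * (D + weighted_norm \<gamma> ((X j k, Y j k) - ws) + e / 2 + T) \<le> w * R"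
    using wk e nonneg by (intro mult_left_mono) (auto simp: R_def)
  finally have "r * (c \<bullet> fst (out j k) + b \<bullet> snd (out j k)) \<le> w * R + W"
    by simp
  moreover have "0 \<le> w * R + W"
    using nonneg W by (simp add: R_def)
  ultimately have b3: "r * p3 \<le> w * R + W"
    by (simp add: p3_def max_def)
  have "pos_part (- fst (out j k)) = 0"
    using output_nonneg [of j k] by (simp add: nonneg_orthant_def pos_part_def vec_eq_iff max_def)
  then have "lp_metric A b c (out j k) = sqrt (p1\<^sup>2 + p2\<^sup>2 + p3\<^sup>2)"
    by (simp add: lp_metric_def case_prod_unfold p1_def p2_def p3_def)
  also have "\<dots> \<le> p1 + p2 + p3"
    by (intro order.trans [OF sqrt_add_le_add_sqrt] add_mono) (auto simp: p1_def p2_def p3_def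
        intro!: order.trans [OF sqrt_add_le_add_sqrt])
  finally have "r * lp_metric A b c (out j k) \<le> r * (p1 + p2 + p3)"
    using r by (intro mult_left_mono) auto
  also have "\<dots> \<le> (sqrt \<gamma> + 1 / sqrt \<gamma> + w) * R + W"
    using b1 b2 b3 by (simp add: distrib_left distrib_right)
  finally show ?thesis
    by (simp add: r_def R_def U_def T_def w_def)
qed

section \<open>Averaging over the sampled blocks\<close>

lemma state_cong:
  "(\<And>i. i \<in> {1..k} \<Longrightarrow> j i = j' i) \<Longrightarrow>
    clvr_state A b c S m \<gamma> x0 y0 j k = clvr_state A b c S m \<gamma> x0 y0 j' k"
  by (induction k) (simp_all add: Let_def case_prod_unfold)

lemma X_cong: "(\<And>i. i \<in> {1..k} \<Longrightarrow> j i = j' i) \<Longrightarrow> X j k = X j' k"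
  and Y_cong: "(\<And>i. i \<in> {1..k} \<Longrightarrow> j i = j' i) \<Longrightarrow> Y j k = Y j' k"
  and Q_cong: "(\<And>i. i \<in> {1..k} \<Longrightarrow> j i = j' i) \<Longrightarrow> Q j k = Q j' k"
  using state_cong [of k j j'] by (simp_all add: clvr_x_def clvr_y_def Q_def)

lemma dual_step_cong: "(\<And>i. i \<in> {1..k} \<Longrightarrow> j i = j' i) \<Longrightarrow> dual_step j k = dual_step j' k"
  unfolding dual_step_def by (intro arg_cong2 [where f = minus] Y_cong) auto

lemma noise_cong: "(\<And>i. i \<in> {1..k} \<Longrightarrow> j i = j' i) \<Longrightarrow> noise j k = noise j' k"
  unfolding noise_def using X_cong [of k j j'] dual_step_cong [of k j j'] by auto

lemma output_cong:
  assumes "\<And>i. i \<in> {1..k} \<Longrightarrow> j i = j' i"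
  shows "out j k = out j' k"
proof -
  have "X j i = X j' i" "Y j i = Y j' i" "Y j (i - 1) = Y j' (i - 1)" if "i \<in> {1..k}" for i
    using assms that by (auto intro!: X_cong Y_cong)
  then show ?thesis
    unfolding clvr_output_def by (auto intro!: sum.cong)
qed

text \<open>
  The point \<open>x\<^sub>k\<^sub>+\<^sub>1\<close> is computed before block \<open>k + 1\<close> is drawn.
\<close>

lemma X_fun_upd_Suc: "X (j(Suc k := l)) (Suc k) = X j (Suc k)"
  unfolding X_Suc using Q_cong [of k "j(Suc k := l)" j] by simp

lemma dual_step_fun_upd_Suc:
  "dual_step (j(Suc k := l)) (Suc k) = (\<gamma> * real m * a) *\<^sub>R subvec (A *v X j (Suc k) - b) (S l)"
  by (simp add: dual_step_Suc X_fun_upd_Suc)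

lemma noise_fun_upd_Suc:
  "noise (j(Suc k := l)) (Suc k)
    = a *\<^sub>R ((A *v X j (Suc k) - b) - real m *\<^sub>R subvec (A *v X j (Suc k) - b) (S l))"
proof -
  define v where "v = A *v X j (Suc k) - b"
  have "noise (j(Suc k := l)) (Suc k)
      = a *\<^sub>R v - (1 / \<gamma>) *\<^sub>R ((\<gamma> * real m * a) *\<^sub>R subvec v (S l))"
    by (simp only: noise_def dual_step_fun_upd_Suc X_fun_upd_Suc v_def)
  then show ?thesis
    unfolding v_def [symmetric] using gamma_pos by (simp add: algebra_simps)
qed

lemma sum_subvec_blocks: "(\<Sum>l=1..m. subvec v (S l)) = v"
proof -
  have "(\<Sum>l=1..m. if i \<in> S l then v $ i else 0) = v $ i" for i
  proof -
    have "i \<in> (\<Union>l\<in>{1..m}. S l)"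
      using partition by (simp add: is_block_partition_def)
    then obtain l0 where l0: "l0 \<in> {1..m}" "i \<in> S l0"
      by blast
    have "i \<in> S l \<longleftrightarrow> l = l0" if "l \<in> {1..m}" for l
      using partition l0 that unfolding is_block_partition_def disjoint_family_on_def by blast
    then have "(\<Sum>l=1..m. if i \<in> S l then v $ i else 0) = (\<Sum>l=1..m. if l = l0 then v $ i else 0)"
      by (intro sum.cong) auto
    then show ?thesis using l0 by simp
  qed
  then show ?thesis
    by (simp add: vec_eq_iff subvec_def)
qed

lemma sum_norm_subvec_blocks: "(\<Sum>l=1..m. (norm (subvec v (S l)))\<^sup>2) = (norm v)\<^sup>2"
proof -
  have "(\<Sum>l=1..m. (norm (subvec v (S l)))\<^sup>2) = (\<Sum>l=1..m. subvec v (S l) \<bullet> v)"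
    by (simp add: power2_norm_eq_inner inner_subvec [of v _ v])
  then show ?thesis
    by (simp only: inner_sum_left [symmetric] sum_subvec_blocks power2_norm_eq_inner)
qed

lemma sum_noise_fun_upd: "(\<Sum>l=1..m. noise (j(Suc k := l)) (Suc k)) = 0"
proof -
  define v where "v = A *v X j (Suc k) - b"
  have "(\<Sum>l=1..m. noise (j(Suc k := l)) (Suc k)) = a *\<^sub>R ((\<Sum>l=1..m. v) - real m *\<^sub>R v)"
    by (simp only: noise_fun_upd_Suc v_def [symmetric] scaleR_sum_right [symmetric] sum_subtractf
        sum_subvec_blocks)
  also have "(\<Sum>l=1..m. v) = real m *\<^sub>R v"
    by (simp only: sum_constant_scaleR card_atLeastAtMost) simp
  finally show ?thesis by (simp only: diff_self scaleR_zero_right)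
qed

text \<open>
  For one draw, the variance of the estimate \<open>m v\<^sup>S\<close> of the residual \<open>v\<close> is at most its second moment,
  and that is the second moment of the dual step up to scaling.
\<close>

lemma sum_norm_noise_fun_upd_le:
  "\<gamma>\<^sup>2 * (\<Sum>l=1..m. (norm (noise (j(Suc k := l)) (Suc k)))\<^sup>2)
    \<le> (\<Sum>l=1..m. (norm (dual_step (j(Suc k := l)) (Suc k)))\<^sup>2)"
proof -
  define v where "v = A *v X j (Suc k) - b"
  have "(norm (v - real m *\<^sub>R subvec v (S l)))\<^sup>2
      = (norm v)\<^sup>2 - 2 * real m * (subvec v (S l) \<bullet> v) + (real m)\<^sup>2 * (norm (subvec v (S l)))\<^sup>2" for l
    unfolding power2_norm_eq_inner
    by (simp add: inner_diff_left inner_diff_right inner_commute power2_eq_square algebra_simps)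
  then have "(\<Sum>l=1..m. (norm (v - real m *\<^sub>R subvec v (S l)))\<^sup>2)
      = real m * (norm v)\<^sup>2 - 2 * real m * (norm v)\<^sup>2 + (real m)\<^sup>2 * (norm v)\<^sup>2"
    by (simp add: sum.distrib sum_subtractf sum_distrib_left [symmetric] inner_sum_left [symmetric]
        sum_norm_subvec_blocks [simplified] sum_subvec_blocks [simplified])
      (simp add: power2_norm_eq_inner)
  also have "\<dots> \<le> (real m)\<^sup>2 * (norm v)\<^sup>2"
    by simp
  finally have "\<gamma>\<^sup>2 * (a\<^sup>2 * (\<Sum>l=1..m. (norm (v - real m *\<^sub>R subvec v (S l)))\<^sup>2))
      \<le> \<gamma>\<^sup>2 * (a\<^sup>2 * ((real m)\<^sup>2 * (norm v)\<^sup>2))"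
    by (intro mult_left_mono) auto
  then show ?thesis
    by (simp add: noise_fun_upd_Suc dual_step_fun_upd_Suc v_def [symmetric] power_mult_distrib
        sum_distrib_left [symmetric] sum_norm_subvec_blocks [simplified] mult_ac)
qed

text \<open>
  Martingale property: in the last summand only the noise depends on the last draw.
\<close>

lemma mean_noise_pairing: "seq_mean m k (\<lambda>j. noise_pairing v j k) = 0"
proof (induction k)
  case 0
  then show ?case by (simp add: noise_pairing_def seq_mean_def)
next
  case (Suc k)
  have "(\<Sum>l=1..m. noise_pairing v (j(Suc k := l)) (Suc k)) / real m = noise_pairing v j k" for j
  proof -
    have past: "noise (j(Suc k := l)) i = noise j i" "Y (j(Suc k := l)) (i - 1) = Y j (i - 1)"
      if "i \<in> {1..k}" for i l
      using that by (auto intro!: noise_cong Y_cong)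
    have "Y (j(Suc k := l)) k = Y j k" for l
      by (rule Y_cong) auto
    then have "noise_pairing v (j(Suc k := l)) (Suc k)
        = noise_pairing v j k + (v - Y j k) \<bullet> noise (j(Suc k := l)) (Suc k)" for l
      by (auto simp: noise_pairing_def past [simplified] intro!: sum.cong)
    then show ?thesis
      using m_pos by (simp add: sum.distrib inner_sum_right [symmetric]
          sum_noise_fun_upd [simplified])
  qed
  then show ?case
    by (simp add: seq_mean_Suc Suc)
qed

text \<open>
  The cross terms between the past noise and the new noise vanish in the mean, so the second moments
  add up, each dominated by that of the dual step.
\<close>

lemma mean_total_noise_le:
  "\<gamma>\<^sup>2 * seq_mean m k (\<lambda>j. (norm (total_noise j k))\<^sup>2) \<le> seq_mean m k (\<lambda>j. dual_path j k)"
proof (induction k)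
  case 0
  then show ?case by (simp add: total_noise_def dual_path_def seq_mean_def)
next
  case (Suc k)
  define \<Delta> where "\<Delta> j = (\<Sum>l=1..m. (norm (dual_step (j(Suc k := l)) (Suc k)))\<^sup>2) / real m" for j
  define \<Xi> where "\<Xi> j = (\<Sum>l=1..m. (norm (noise (j(Suc k := l)) (Suc k)))\<^sup>2) / real m" for j
  have past: "noise (j(Suc k := l)) i = noise j i" "dual_step (j(Suc k := l)) i = dual_step j i"
    if "i \<in> {1..k}" for i l j
    using that by (auto intro!: noise_cong dual_step_cong)
  have "total_noise (j(Suc k := l)) (Suc k) = total_noise j k + noise (j(Suc k := l)) (Suc k)" for j l
    by (auto simp: total_noise_def past intro!: sum.cong)
  then have "(norm (total_noise (j(Suc k := l)) (Suc k)))\<^sup>2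
      = (norm (total_noise j k))\<^sup>2 + 2 * (total_noise j k \<bullet> noise (j(Suc k := l)) (Suc k))
        + (norm (noise (j(Suc k := l)) (Suc k)))\<^sup>2" for j l
    unfolding power2_norm_eq_inner by (simp add: inner_add_left inner_add_right inner_commute)
  then have noise: "(\<Sum>l=1..m. (norm (total_noise (j(Suc k := l)) (Suc k)))\<^sup>2) / real m
      = (norm (total_noise j k))\<^sup>2 + \<Xi> j" for j
    using m_pos by (simp add: \<Xi>_def sum.distrib sum_distrib_left [symmetric] inner_sum_right [symmetric]
        sum_noise_fun_upd [simplified] add_divide_distrib)
  have "dual_path (j(Suc k := l)) (Suc k)
      = dual_path j k + (norm (dual_step (j(Suc k := l)) (Suc k)))\<^sup>2" for j l
    by (auto simp: dual_path_def past intro!: sum.cong)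
  then have path: "(\<Sum>l=1..m. dual_path (j(Suc k := l)) (Suc k)) / real m = dual_path j k + \<Delta> j" for j
    using m_pos by (simp add: \<Delta>_def sum.distrib add_divide_distrib)
  have "\<gamma>\<^sup>2 * \<Xi> j \<le> \<Delta> j" for j
    using sum_norm_noise_fun_upd_le [of j k] by (simp add: \<Xi>_def \<Delta>_def divide_right_mono)
  then have "\<gamma>\<^sup>2 * seq_mean m k \<Xi> \<le> seq_mean m k \<Delta>"
    unfolding seq_mean_cmult [symmetric] by (intro seq_mean_mono)
  with Suc show ?case
    unfolding seq_mean_Suc noise path seq_mean_add by (simp add: distrib_left)
qed

text \<open>
  The pathwise bound is linear in \<open>W\<close>, in \<open>sqrt (4 W)\<close> and in the norm of the total noise. The mean of \<open>W\<close> is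
  \<open>D\<^sup>2 / 2\<close>; by Jensen's inequality each of the other two means is at most \<open>sqrt (2 D\<^sup>2) \<le> 3 D / 2\<close>,
  and \<open>1 + 9 / 4 + 3 / 2 \<le> 5\<close>.
\<close>

lemma mean_lp_metric_le:
  assumes k: "k \<ge> 1" and sol: "ws \<in> primal_dual_solutions A b c"
  defines "D \<equiv> weighted_norm \<gamma> ((x0, y0) - ws)"
  shows "real k * a * seq_mean m k (\<lambda>j. lp_metric A b c (out j k))
    \<le> (sqrt \<gamma> + 1 / sqrt \<gamma> + weighted_norm \<gamma> ws) * (5 * D) + D\<^sup>2 / 2"
proof -
  define K where "K = sqrt \<gamma> + 1 / sqrt \<gamma> + weighted_norm \<gamma> ws"
  define W where "W j = D\<^sup>2 / 2 + noise_pairing (snd ws) j k" for j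
  define T where "T j = sqrt \<gamma> * norm (total_noise j k)" for j
  have D: "D \<ge> 0" and K: "K \<ge> 0"
    using gamma_pos by (simp_all add: D_def K_def weighted_norm_eq)
  have energy: "(weighted_norm \<gamma> ((X j k, Y j k) - ws))\<^sup>2 + dual_path j k / \<gamma> \<le> 4 * W j"
    if "j \<in> block_seqs m k" for j
    unfolding W_def D_def by (rule energy_le [OF k _ sol]) (rule block_seqs_mem [OF that])
  have mean_W: "seq_mean m k W = D\<^sup>2 / 2"
    unfolding W_def by (simp only: seq_mean_add seq_mean_const [OF m_pos] mean_noise_pairing)
  have sqrt_le: "sqrt (2 * D\<^sup>2) \<le> 3 / 2 * D"
    using D by (intro real_le_lsqrt) (auto simp: power2_eq_square)
  have "seq_mean m k (\<lambda>j. sqrt (4 * W j)) \<le> sqrt (seq_mean m k (\<lambda>j. 4 * W j))"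
  proof (rule seq_mean_le_sqrt [OF m_pos])
    fix j assume j: "j \<in> block_seqs m k"
    have "0 \<le> dual_path j k / \<gamma>"
      using dual_path_nonneg gamma_pos by simp
    then have "0 \<le> 4 * W j"
      using energy [OF j] zero_le_power2 [of "weighted_norm \<gamma> ((X j k, Y j k) - ws)"] by linarith
    then show "(sqrt (4 * W j))\<^sup>2 \<le> 4 * W j" by simp
  qed
  then have mean_sqrt: "seq_mean m k (\<lambda>j. sqrt (4 * W j)) \<le> 3 / 2 * D"
    using sqrt_le by (simp add: seq_mean_cmult mean_W)
  have "seq_mean m k T \<le> sqrt (seq_mean m k (\<lambda>j. \<gamma> * (norm (total_noise j k))\<^sup>2))"
    using gamma_pos by (intro seq_mean_le_sqrt m_pos) (simp add: T_def power_mult_distrib)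
  also have "seq_mean m k (\<lambda>j. \<gamma> * (norm (total_noise j k))\<^sup>2) \<le> 2 * D\<^sup>2"
  proof -
    have "\<gamma> * seq_mean m k (\<lambda>j. (norm (total_noise j k))\<^sup>2) \<le> 1 / \<gamma> * seq_mean m k (\<lambda>j. dual_path j k)"
      using mean_total_noise_le [of k] gamma_pos by (simp add: field_simps power2_eq_square)
    also have "\<dots> \<le> seq_mean m k (\<lambda>j. 4 * W j)"
      unfolding seq_mean_cmult [symmetric]
    proof (rule seq_mean_mono)
      fix j assume "j \<in> block_seqs m k"
      from energy [OF this] have "dual_path j k / \<gamma> \<le> 4 * W j"
        using zero_le_power2 [of "weighted_norm \<gamma> ((X j k, Y j k) - ws)"] by linarith
      then show "1 / \<gamma> * dual_path j k \<le> 4 * W j"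
        by simp
    qed
    finally show ?thesis
      by (simp add: seq_mean_cmult mean_W)
  qed
  finally have mean_T: "seq_mean m k T \<le> 3 / 2 * D"
    using sqrt_le by simp
  have "real k * a * seq_mean m k (\<lambda>j. lp_metric A b c (out j k))
      \<le> seq_mean m k (\<lambda>j. K * (D + (3 / 2 * sqrt (4 * W j) + T j)) + W j)"
    unfolding seq_mean_cmult [symmetric] W_def T_def K_def D_def
    by (intro seq_mean_mono lp_metric_le [OF k _ sol]) (rule block_seqs_mem)
  also have "\<dots> = K * (D + (3 / 2 * seq_mean m k (\<lambda>j. sqrt (4 * W j)) + seq_mean m k T)) + D\<^sup>2 / 2"
    by (simp only: seq_mean_add seq_mean_cmult seq_mean_const [OF m_pos] mean_W)
  also have "\<dots> \<le> K * (5 * D) + D\<^sup>2 / 2"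
    using mean_sqrt mean_T D K by (intro add_right_mono mult_left_mono) auto
  finally show ?thesis
    by (simp add: K_def)
qed

end

theorem theorem2:
  fixes A :: "real^'d^'n" and b :: "real^'n" and c :: "real^'d"
    and S :: "nat \<Rightarrow> 'n set" and m k :: nat
    and \<gamma> H C0 :: real
    and x0 :: "real^'d" and y0 :: "real^'n" and w0 wstar :: "(real^'d) \<times> (real^'n)"
    and M :: "'w measure" and J :: "nat \<Rightarrow> 'w \<Rightarrow> nat"
  assumes partition: "is_block_partition S m"
    and L_pos: "Lhat A S m > 0"
    and solvable: "primal_dual_solutions A b c \<noteq> {}"
    and x0: "x0 \<in> nonneg_orthant"
    and w0: "w0 = (x0, y0)"
    and gamma_pos: "\<gamma> > 0"
    and prob: "prob_space M"
    and sampling: "uniform_block_sampling M m J"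
    and wstar: "is_arg_min (\<lambda>w. weighted_norm \<gamma> (w0 - w))
                  (\<lambda>w. w \<in> primal_dual_solutions A b c) wstar"
    and C0: "C0 = \<gamma> + 1 / \<gamma> + (sqrt 2 + 1) * weighted_norm \<gamma> (w0 - wstar) + weighted_norm \<gamma> wstar"
    and H_pos: "H > 0"
    and hoffman: "\<forall>w. lp_metric A b c w \<ge> H * weighted_dist \<gamma> w (primal_dual_solutions A b c)"
    and k: "k \<ge> 1"
  shows "(\<integral>\<omega>. sqrt (weighted_dist \<gamma> (clvr_output A b c S m \<gamma> x0 y0 (\<lambda>i. J i \<omega>) k)
                      (primal_dual_solutions A b c)) \<partial>M)
           \<le> 5 * sqrt (Lhat A S m * real m * C0 / (H * real k))
               * sqrt (weighted_dist \<gamma> w0 (primal_dual_solutions A b c))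
       \<and> (\<integral>\<omega>. sqrt (lp_metric A b c (clvr_output A b c S m \<gamma> x0 y0 (\<lambda>i. J i \<omega>) k)) \<partial>M)
           \<le> 5 * sqrt (Lhat A S m * real m * C0 / (H * real k)) * sqrt (lp_metric A b c w0)"
proof -
  interpret clvr A b c S m \<gamma> x0 y0
    using partition L_pos x0 gamma_pos by unfold_locales
  define W where "W = primal_dual_solutions A b c"
  define D where "D = weighted_norm \<gamma> (w0 - wstar)"
  define wst where "wst = weighted_norm \<gamma> wstar"
  define B where "B = 5 * sqrt (L * real m * C0 / real k) * sqrt D"
  have sol: "wstar \<in> W" and minimal: "\<And>w. w \<in> W \<Longrightarrow> D \<le> weighted_norm \<gamma> (w0 - w)"
    using wstar by (auto simp: is_arg_min_def W_def D_def not_less)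
  have nonneg: "0 \<le> D" "0 \<le> wst"
    using gamma_pos by (simp_all add: D_def wst_def weighted_norm_eq)
  have dist_w0: "weighted_dist \<gamma> w0 W = D"
    unfolding weighted_dist_def
    by (rule cInf_eq_minimum) (use sol minimal in \<open>auto simp: D_def\<close>)
  have C0_eq: "C0 = \<gamma> + 1 / \<gamma> + (sqrt 2 + 1) * D + wst"
    by (simp add: C0 D_def wst_def)
  have sqrt_gamma: "sqrt \<gamma> + 1 / sqrt \<gamma> \<le> \<gamma> + 1 / \<gamma>"
  proof -
    define s where "s = sqrt \<gamma>"
    have s: "s > 0" "\<gamma> = s * s"
      using gamma_pos by (simp_all add: s_def)
    have "s * s + 1 / (s * s) - (s + 1 / s) = (s - 1)\<^sup>2 * (s * s + s + 1) / (s * s)"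
      using s(1) by (simp add: field_simps power2_eq_square)
    also have "\<dots> \<ge> 0"
      using s(1) by simp
    finally show ?thesis
      unfolding s_def [symmetric] unfolding s(2) by simp
  qed
  have C0_nonneg: "0 \<le> C0"
    using gamma_pos nonneg by (simp add: C0_eq)
  have "real k * a * seq_mean m k (\<lambda>j. lp_metric A b c (out j k))
      \<le> (sqrt \<gamma> + 1 / sqrt \<gamma> + wst) * (5 * D) + D\<^sup>2 / 2"
    using mean_lp_metric_le [OF k] sol by (simp add: W_def D_def wst_def w0)
  also have "\<dots> \<le> (\<gamma> + 1 / \<gamma> + wst) * (5 * D) + D * (5 * D)"
  proof (rule add_mono [OF mult_right_mono])
    show "sqrt \<gamma> + 1 / sqrt \<gamma> + wst \<le> \<gamma> + 1 / \<gamma> + wst"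
      using sqrt_gamma by simp
    show "D\<^sup>2 / 2 \<le> D * (5 * D)"
      by (simp add: power2_eq_square)
    show "0 \<le> 5 * D"
      using nonneg by simp
  qed
  also have "\<dots> = (\<gamma> + 1 / \<gamma> + D + wst) * (5 * D)"
    by (simp add: algebra_simps)
  also have "\<dots> \<le> C0 * (5 * D)"
    using nonneg by (intro mult_right_mono) (auto simp: C0_eq algebra_simps)
  finally have "seq_mean m k (\<lambda>j. lp_metric A b c (out j k)) \<le> C0 * (5 * D) / (real k * a)"
    using k a_pos by (simp add: field_simps)
  also have "\<dots> = 10 * (L * real m * C0 / real k * D)"
    using m_pos L_pos by (simp add: a_def field_simps)
  also have "\<dots> \<le> 25 * (L * real m * C0 / real k * D)"
    using L_pos C0_nonneg nonneg by (intro mult_right_mono) auto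
  finally have "sqrt (seq_mean m k (\<lambda>j. lp_metric A b c (out j k)))
      \<le> sqrt (25 * (L * real m * C0 / real k * D))"
    by simp
  also have "\<dots> = B"
    by (simp only: B_def real_sqrt_mult) simp
  finally have mean_lp: "seq_mean m k (\<lambda>j. sqrt (lp_metric A b c (out j k))) \<le> B"
    by (intro order.trans [OF seq_mean_le_sqrt [OF m_pos]])
      (auto simp: lp_metric_def case_prod_unfold)
  have "seq_mean m k (\<lambda>j. sqrt (weighted_dist \<gamma> (out j k) W))
      \<le> seq_mean m k (\<lambda>j. 1 / sqrt H * sqrt (lp_metric A b c (out j k)))"
  proof (rule seq_mean_mono)
    fix j
    have "sqrt H * sqrt (weighted_dist \<gamma> (out j k) W) \<le> sqrt (lp_metric A b c (out j k))"
      using hoffman [rule_format, of "out j k"] by (simp add: W_def real_sqrt_mult [symmetric])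
    then show "sqrt (weighted_dist \<gamma> (out j k) W) \<le> 1 / sqrt H * sqrt (lp_metric A b c (out j k))"
      using H_pos by (simp add: field_simps)
  qed
  also have "\<dots> \<le> 1 / sqrt H * B"
    unfolding seq_mean_cmult using mean_lp H_pos by (intro mult_left_mono) auto
  finally have mean_dist: "seq_mean m k (\<lambda>j. sqrt (weighted_dist \<gamma> (out j k) W)) \<le> 1 / sqrt H * B" .
  have B: "1 / sqrt H * B = 5 * sqrt (L * real m * C0 / (H * real k)) * sqrt D"
    by (simp add: B_def real_sqrt_mult real_sqrt_divide)
  have "sqrt H * sqrt D \<le> sqrt (lp_metric A b c w0)"
    using hoffman [rule_format, of w0] dist_w0 by (simp add: W_def real_sqrt_mult [symmetric])
  then have "5 * sqrt (L * real m * C0 / (H * real k)) * (sqrt H * sqrt D)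
      \<le> 5 * sqrt (L * real m * C0 / (H * real k)) * sqrt (lp_metric A b c w0)"
    using L_pos C0_nonneg H_pos by (intro mult_left_mono) auto
  also have "5 * sqrt (L * real m * C0 / (H * real k)) * (sqrt H * sqrt D) = B"
    using H_pos by (simp add: B_def real_sqrt_mult real_sqrt_divide)
  finally have B_le: "B \<le> 5 * sqrt (L * real m * C0 / (H * real k)) * sqrt (lp_metric A b c w0)" .
  have "(\<integral>\<omega>. sqrt (weighted_dist \<gamma> (out (\<lambda>i. J i \<omega>) k) W) \<partial>M)
      = seq_mean m k (\<lambda>j. sqrt (weighted_dist \<gamma> (out j k) W))"
    using integral_uniform_block_sampling [OF prob sampling m_pos, where k = k
        and f = "\<lambda>j. sqrt (weighted_dist \<gamma> (out j k) W)"] output_cong [of k] by metis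
  moreover have "(\<integral>\<omega>. sqrt (lp_metric A b c (out (\<lambda>i. J i \<omega>) k)) \<partial>M)
      = seq_mean m k (\<lambda>j. sqrt (lp_metric A b c (out j k)))"
    using integral_uniform_block_sampling [OF prob sampling m_pos, where k = k
        and f = "\<lambda>j. sqrt (lp_metric A b c (out j k))"] output_cong [of k] by metis
  ultimately show ?thesis
    using mean_dist mean_lp B_le unfolding W_def [symmetric] dist_w0 B by linarith
qed

end
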